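(* Let $\Omega\subset\mathbb{R}^N$ be a bounded $C^1$-domain, and let $\mathcal{I}$ be a nonlocal operator $\mathcal{I}(u,x)=\int_{\mathbb{R}^N}[u(x+z)-u(x)]\,\nu_x(dz)$ satisfying assumptions (M0), (M1), (M2) listed in the context with the same $\sigma\in(0,1)$. Let $m>\sigma$, $b_0>0$, $A_0\ge 0$. If $u$ is a bounded viscosity subsolution to $$-\mathcal{I}(u,x)+b_0|Du|^m=A_0\quad\text{in }\Omega,$$ then there exists a constant $L>0$ such that $$|u(x)-u(y)|\le L|x-y|\qquad\text{for all }x,y\in\Omega,$$ where $L$ depends on the data and on $\mathrm{osc}_{\bar\Omega}(u)$.
   Context: Notation: $d(x)=\mathrm{dist}(x,\partial\Omega)$, $\Omega_r=\{x\in\Omega: d(x)<r\}$, $B_r(x)$ is the open ball, $B_r=B_r(0)$, $B_r^c$ its complement. "$C^1$-domain" means that the boundary is $C^1$, with the convention that there is $\delta_0>0$ such that $d$ is of class $C^1$ in $\Omega_{\delta_0}$. $\mathrm{osc}_{\bar\Omega}(u)=\sup_{\bar\Omega}u-\inf_{\bar\Omega}u$. "The data" means $N,\Omega,\sigma,m,b_0,A_0$ and the constants $C_1,C_2$ below. For each $x\in\bar\Omega$, $\nu_x$ is a nonnegative regular measure on $\mathbb{R}^N$. For $D\subset\mathbb{R}^N$, $\mathcal{I}[D](u,y)=\int_D[u(y+z)-u(y)]\nu_y(dz)$. (M0): (M0-1) $\bigcup_{x\in\bar\Omega}\{x+\mathrm{supp}\,\nu_x\}\subseteq\bar\Omega$.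 (M0-2) if $x\in\bar\Omega$, $r>0$ and $u\in L^\infty(\bar\Omega)$ is $C^1$ in $B_r(x)$ (i.e. in $B_r(x)\cap\bar\Omega$), then $\mathcal{I}(u,x)$ is well defined, and for any $D\subset\mathbb{R}^N$ the map $y\mapsto\mathcal{I}[D](u,y)$ is continuous in $B_r(x)$ (i.e. in $B_r(x)\cap\bar\Omega$). (M1): there is $C_1>0$ such that for all $\beta\in[0,2]$ and $\delta>0$, $\sup_{x\in\bar\Omega}\int_{B_\delta^c}\min\{1,|z|^\beta\}\nu_x(dz)\le C_1h_{\beta,\sigma}(\delta)$, where $h_{\beta,\sigma}(\delta)=\delta^{\beta-\sigma}$ if $\beta<\sigma$, $=|\ln\delta|+1$ if $\beta=\sigma$, $=1$ if $\beta>\sigma$ (convention $|z|^0=1$). (M2): there is $C_2>0$ such that for all $\beta\in(\sigma,2]$ and $\delta\in(0,1)$, $\sup_{x\in\bar\Omega}\int_{B_\delta}|z|^\beta\nu_x(dz)\le C_2\delta^{\beta-\sigma}$. Viscosity subsolution in $\Omega$: an upper semicontinuous $u:\bar\Omega\to\mathbb{R}$ such that whenever $\phi\in C^1(\bar\Omega)$ and $u-\phi$ has a maximum on $\bar\Omega$ at $x_0\in\Omega$, then for all $\delta>0$, $-\mathcal{I}[B_\delta](\phi,x_0)-\mathcal{I}[B_\delta^c](u,x_0)+b_0|D\phi(x_0)|^m\le A_0$. *)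

theory Defs
  imports "HOL-Analysis.Analysis"
begin

section \<open>Functions of class C1 and C1 domains\<close>

text \<open>
  The derivative is taken within S, so that the notion also applies to relatively open subsets of
  the closure of a C1 domain (class C1 up to the boundary). There the gradient is unique; for open
  S this is the usual notion.
\<close>

definition C1_gradient_on :: "('a::euclidean_space \<Rightarrow> real) \<Rightarrow> ('a \<Rightarrow> 'a) \<Rightarrow> 'a set \<Rightarrow> bool" where
  "C1_gradient_on f G S \<longleftrightarrow>
     continuous_on S G \<and> (\<forall>x\<in>S. (f has_derivative (\<lambda>h. G x \<bullet> h)) (at x within S))"

definition C1_on :: "('a::euclidean_space \<Rightarrow> real) \<Rightarrow> 'a set \<Rightarrow> bool" where
  "C1_on f S \<longleftrightarrow> (\<exists>G. C1_gradient_on f G S)"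

text \<open>
  Near each boundary point the set is the strict supergraph of a C1 function over the hyperplane
  orthogonal to some unit vector e; the function \<gamma> is only evaluated on that hyperplane.
\<close>

definition C1_boundary :: "'a::euclidean_space set \<Rightarrow> bool" where
  "C1_boundary \<Omega> \<longleftrightarrow>
     (\<forall>p\<in>frontier \<Omega>. \<exists>r>0. \<exists>e \<gamma>. norm e = 1 \<and> C1_on \<gamma> UNIV \<and>
        \<Omega> \<inter> ball p r = {x \<in> ball p r. x \<bullet> e > \<gamma> (x - (x \<bullet> e) *\<^sub>R e)})"

definition C1_domain :: "'a::euclidean_space set \<Rightarrow> bool" where
  "C1_domain \<Omega> \<longleftrightarrow>
     open \<Omega> \<and> connected \<Omega> \<and> \<Omega> \<noteq> {} \<and> C1_boundary \<Omega> \<and>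
     (\<exists>\<delta>0>0. C1_on (\<lambda>x. infdist x (frontier \<Omega>)) {x \<in> \<Omega>. infdist x (frontier \<Omega>) < \<delta>0})"

definition usc_on :: "('a::topological_space \<Rightarrow> real) \<Rightarrow> 'a set \<Rightarrow> bool" where
  "usc_on u S \<longleftrightarrow> (\<forall>x\<in>S. \<forall>a>u x. eventually (\<lambda>y. u y < a) (at x within S))"

definition osc :: "('a \<Rightarrow> real) \<Rightarrow> 'a set \<Rightarrow> real" where
  "osc u S = Sup (u ` S) - Inf (u ` S)"

section \<open>The nonlocal operator\<close>

text \<open>
  Regularity is required away from the origin, both from inside and from outside: the measures of
  interest may have infinite mass near 0, and then the null set consisting of 0 alone is not outer
  regular in the whole space. A mass at 0 contributes nothing to the integrals below.
\<close>

definition regular_borel_measure :: "'a::euclidean_space measure \<Rightarrow> bool" where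
  "regular_borel_measure \<mu> \<longleftrightarrow>
     sets \<mu> = sets borel \<and>
     (\<forall>B\<in>sets borel. 0 \<notin> B \<longrightarrow>
        emeasure \<mu> B = (SUP K\<in>{K. compact K \<and> K \<subseteq> B}. emeasure \<mu> K) \<and>
        emeasure \<mu> B = (INF U\<in>{U. open U \<and> B \<subseteq> U \<and> 0 \<notin> U}. emeasure \<mu> U))"

definition supp :: "'a::topological_space measure \<Rightarrow> 'a set" where
  "supp \<mu> = {z. \<forall>U. open U \<and> z \<in> U \<longrightarrow> emeasure \<mu> U > 0}"

text \<open>
  A function u on the closure of \<Omega> is represented by a total function, whose values elsewhere
  are arbitrary and possibly not measurable. The domain of integration is therefore cut down to
  those z with y + z in the closure of \<Omega>; by the support condition in M0 the removed set is \<nu> y-null.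
\<close>

definition nl_domain :: "'a::euclidean_space set \<Rightarrow> 'a set \<Rightarrow> 'a \<Rightarrow> 'a set" where
  "nl_domain \<Omega> D y = {z \<in> D. y + z \<in> closure \<Omega>}"

definition nl_op ::
  "'a::euclidean_space set \<Rightarrow> ('a \<Rightarrow> 'a measure) \<Rightarrow> 'a set \<Rightarrow> ('a \<Rightarrow> real) \<Rightarrow> 'a \<Rightarrow> real" where
  "nl_op \<Omega> \<nu> D u y = (LINT z:nl_domain \<Omega> D y|\<nu> y. u (y + z) - u y)"

definition nl_well_defined ::
  "'a::euclidean_space set \<Rightarrow> ('a \<Rightarrow> 'a measure) \<Rightarrow> ('a \<Rightarrow> real) \<Rightarrow> 'a \<Rightarrow> bool" where
  "nl_well_defined \<Omega> \<nu> u y \<longleftrightarrow>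
     set_integrable (\<nu> y) (nl_domain \<Omega> UNIV y) (\<lambda>z. u (y + z) - u y)"

text \<open>
  Since u is integrated against measures that may be singular, membership in the space of
  essentially bounded functions means here: bounded and Borel measurable, defined at every point.
\<close>

definition M0 :: "'a::euclidean_space set \<Rightarrow> ('a \<Rightarrow> 'a measure) \<Rightarrow> bool" where
  "M0 \<Omega> \<nu> \<longleftrightarrow>
     (\<Union>x\<in>closure \<Omega>. (\<lambda>z. x + z) ` supp (\<nu> x)) \<subseteq> closure \<Omega> \<and>
     (\<forall>x\<in>closure \<Omega>. \<forall>r>0. \<forall>u.
        u \<in> borel_measurable (restrict_space borel (closure \<Omega>)) \<and>
        bounded (u ` closure \<Omega>) \<and>
        C1_on u (ball x r \<inter> closure \<Omega>) \<longrightarrow>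
          nl_well_defined \<Omega> \<nu> u x \<and>
          (\<forall>D\<in>sets borel. continuous_on (ball x r \<inter> closure \<Omega>) (\<lambda>y. nl_op \<Omega> \<nu> D u y)))"

definition h_fun :: "real \<Rightarrow> real \<Rightarrow> real \<Rightarrow> real" where
  "h_fun \<beta> \<sigma> \<delta> =
     (if \<beta> < \<sigma> then \<delta> powr (\<beta> - \<sigma>) else if \<beta> = \<sigma> then \<bar>ln \<delta>\<bar> + 1 else 1)"

text \<open>
  The integrand is only evaluated at nonzero z, where \<open>norm z powr 0 = 1\<close> as required.
\<close>

definition M1 :: "'a::euclidean_space set \<Rightarrow> ('a \<Rightarrow> 'a measure) \<Rightarrow> real \<Rightarrow> real \<Rightarrow> bool" where
  "M1 \<Omega> \<nu> \<sigma> C1 \<longleftrightarrow>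
     (\<forall>\<beta>\<in>{0..2}. \<forall>\<delta>>0.
        (SUP x\<in>closure \<Omega>. \<integral>\<^sup>+z\<in>- ball 0 \<delta>. ennreal (min 1 (norm z powr \<beta>)) \<partial>\<nu> x)
          \<le> ennreal (C1 * h_fun \<beta> \<sigma> \<delta>))"

definition M2 :: "'a::euclidean_space set \<Rightarrow> ('a \<Rightarrow> 'a measure) \<Rightarrow> real \<Rightarrow> real \<Rightarrow> bool" where
  "M2 \<Omega> \<nu> \<sigma> C2 \<longleftrightarrow>
     (\<forall>\<beta>\<in>{\<sigma><..2}. \<forall>\<delta>\<in>{0<..<1}.
        (SUP x\<in>closure \<Omega>. \<integral>\<^sup>+z\<in>ball 0 \<delta>. ennreal (norm z powr \<beta>) \<partial>\<nu> x)
          \<le> ennreal (C2 * \<delta> powr (\<beta> - \<sigma>)))"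

section \<open>Viscosity subsolutions\<close>

definition viscosity_subsolution ::
  "'a::euclidean_space set \<Rightarrow> ('a \<Rightarrow> 'a measure) \<Rightarrow> real \<Rightarrow> real \<Rightarrow> real \<Rightarrow> ('a \<Rightarrow> real) \<Rightarrow> bool" where
  "viscosity_subsolution \<Omega> \<nu> m b0 A0 u \<longleftrightarrow>
     usc_on u (closure \<Omega>) \<and>
     (\<forall>\<phi> D\<phi> x0. C1_gradient_on \<phi> D\<phi> (closure \<Omega>) \<and> x0 \<in> \<Omega> \<and>
        (\<forall>y\<in>closure \<Omega>. u y - \<phi> y \<le> u x0 - \<phi> x0) \<longrightarrow>
        (\<forall>\<delta>>0. - nl_op \<Omega> \<nu> (ball 0 \<delta>) \<phi> x0 - nl_op \<Omega> \<nu> (- ball 0 \<delta>) u x0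
                 + b0 * norm (D\<phi> x0) powr m \<le> A0))"

end

theory Submission
  imports Defs
begin

text \<open>
  Fix a point \<open>x0\<close> and look at a maximum point \<open>y0\<close> of \<open>u - L * norm (y - x0)\<close>. If it differs from
  \<open>x0\<close> and is interior, the equation gives \<open>b0 * L powr m \<le> A0 + const * L powr \<sigma>\<close>: jumps shorter than
  \<open>1 / L\<close> increase \<open>u\<close> by at most \<open>L * norm z\<close>, longer ones by at most the oscillation. As
  \<open>m > \<sigma>\<close>, this is impossible for large \<open>L\<close>, so \<open>u y - u x0 \<le> L * norm (y - x0)\<close>.

  To keep the maximum away from the boundary, let \<open>\<rho>\<close> be a local \<open>C\<^sup>1\<close> defining function of the
  domain and subtract the barrier \<open>\<epsilon> / \<rho> - k * \<rho> powr \<gamma>\<close>. The gradient of the test function is then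
  \<open>L *\<^sub>R e - \<mu> *\<^sub>R G\<close>, where \<open>e\<close> points from \<open>x0\<close> to \<open>y0\<close> and \<open>G\<close> is the inner normal direction.
  When \<open>y0\<close> is closer to the boundary than \<open>x0\<close> the two terms cannot cancel, because the domain is
  \<open>C\<^sup>1\<close>; hence the gradient has size at least \<open>(L + \<mu>) / 2\<close>. First \<open>k\<close> is kept fixed, which bounds
  \<open>\<rho> y0\<close> from below uniformly in \<open>\<epsilon>\<close>; letting \<open>\<epsilon>\<close> tend to 0 removes the unbounded part of the
  barrier. By concavity, jumps shorter than a multiple of \<open>1 / (L + \<mu>)\<close> are controlled by the
  remaining part, so the argument above applies, and finally \<open>k\<close> tends to 0.
\<close>

section \<open>Semicontinuity, oscillation and moments of the jump measures\<close>

text \<open>Without a maximum, every \<open>x\<close> has a better point \<open>w x\<close>, and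
  \<open>f < f (w x)\<close> persists near \<open>x\<close>. Among the finitely many
  \<open>w c\<close> of a finite subcover the best one would have to beat itself.\<close>

lemma usc_on_attains_max:
  fixes f :: "'a::topological_space \<Rightarrow> real"
  assumes "compact S" "S \<noteq> {}" "usc_on f S"
  shows "\<exists>x\<in>S. \<forall>y\<in>S. f y \<le> f x"
proof (rule ccontr)
  assume "\<not> ?thesis"
  then have "\<forall>x\<in>S. \<exists>y\<in>S. f x < f y" by (meson not_le)
  then obtain w where w: "\<And>x. x \<in> S \<Longrightarrow> w x \<in> S \<and> f x < f (w x)" by metis
  have "\<exists>U. open U \<and> x \<in> U \<and> (\<forall>y\<in>U \<inter> S. f y < f (w x))" if "x \<in> S" for x
  proof -
    have "eventually (\<lambda>y. f y < f (w x)) (at x within S)"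
      using assms(3) w[OF that] that unfolding usc_on_def by blast
    then obtain U where "open U" "x \<in> U" "\<forall>y\<in>U. y \<noteq> x \<longrightarrow> y \<in> S \<longrightarrow> f y < f (w x)"
      unfolding eventually_at_topological by blast
    then show ?thesis using w[OF that] by (metis IntD1 IntD2)
  qed
  then obtain U where U: "\<And>x. x \<in> S \<Longrightarrow> open (U x) \<and> x \<in> U x \<and> (\<forall>y\<in>U x \<inter> S. f y < f (w x))"
    by metis
  have "\<And>x. x \<in> S \<Longrightarrow> open (U x)" "S \<subseteq> (\<Union>x\<in>S. U x)" using U by auto
  then obtain C where C: "C \<subseteq> S" "finite C" "S \<subseteq> (\<Union>c\<in>C. U c)"
    using compactE_image[OF assms(1), of S U] by metis
  have "C \<noteq> {}" using C(3) assms(2) by auto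
  then have "Max ((\<lambda>d. f (w d)) ` C) \<in> (\<lambda>d. f (w d)) ` C" using C(2) by (intro Max_in) auto
  then obtain c where "c \<in> C" and cmax: "f (w c) = Max ((\<lambda>d. f (w d)) ` C)" by (metis imageE)
  then have c: "c \<in> C" "\<And>d. d \<in> C \<Longrightarrow> f (w d) \<le> f (w c)"
    using C(2) by auto
  have "w c \<in> S" using c C w by blast
  then obtain d where "d \<in> C" "w c \<in> U d" using C by blast
  then have "f (w c) < f (w d)" using U[of d] C(1) \<open>w c \<in> S\<close> by blast
  with c(2)[OF \<open>d \<in> C\<close>] show False by simp
qed

lemma usc_on_add_continuous:
  fixes u f :: "'a::topological_space \<Rightarrow> real"
  assumes "usc_on u S" "T \<subseteq> S" "continuous_on T f"
  shows "usc_on (\<lambda>x. u x + f x) T"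
  unfolding usc_on_def
proof (intro ballI allI impI)
  fix x a assume x: "x \<in> T" and a: "u x + f x < a"
  define e where "e = (a - (u x + f x)) / 2"
  have e: "e > 0" using a by (simp add: e_def)
  have 1: "eventually (\<lambda>y. u y < u x + e) (at x within T)"
  proof -
    have "eventually (\<lambda>y. u y < u x + e) (at x within S)"
      using assms(1,2) x e unfolding usc_on_def by (metis less_add_same_cancel1 subsetD)
    then show ?thesis by (meson assms(2) at_le filter_leD)
  qed
  have 2: "eventually (\<lambda>y. f y < f x + e) (at x within T)"
    using assms(3) x e unfolding continuous_on_def
    by (intro order_tendstoD(2)[of f "f x"]) auto
  show "eventually (\<lambda>y. u y + f y < a) (at x within T)"
    using 1 2
  proof eventually_elim
    case (elim y)
    then show ?case by (simp add: e_def field_simps)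
  qed
qed

lemma diff_le_osc:
  assumes "bounded (u ` S)" "x \<in> S" "y \<in> S"
  shows "u x - u y \<le> osc u S"
proof -
  have "u x \<le> Sup (u ` S)" "Inf (u ` S) \<le> u y"
    using assms by (auto intro!: cSUP_upper cINF_lower bounded_imp_bdd_above bounded_imp_bdd_below)
  then show ?thesis unfolding osc_def by linarith
qed

text \<open>This is the case \<beta> = 0, where the integrand is 1 off the ball: long jumps have
  finite total mass.\<close>

lemma M1_tail:
  assumes "M1 \<Omega> \<nu> \<sigma> C1" "0 < \<sigma>" "\<delta> > 0" "x \<in> closure \<Omega>" "sets (\<nu> x) = sets borel"
  shows "emeasure (\<nu> x) (- ball 0 \<delta>) \<le> ennreal (C1 * \<delta> powr (- \<sigma>))"
proof -
  have "(SUP x\<in>closure \<Omega>. \<integral>\<^sup>+z\<in>- ball 0 \<delta>. ennreal (min 1 (norm z powr 0)) \<partial>\<nu> x) \<le> ennreal (C1 * h_fun 0 \<sigma> \<delta>)"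
    using assms(1)[unfolded M1_def, THEN bspec[of _ _ 0]] assms(3) by (meson atLeastAtMost_iff order.refl zero_le_numeral)
  then have "(\<integral>\<^sup>+z\<in>- ball 0 \<delta>. ennreal (min 1 (norm z powr 0)) \<partial>\<nu> x) \<le> ennreal (C1 * h_fun 0 \<sigma> \<delta>)"
    by (rule order_trans[OF SUP_upper[OF assms(4)]])
  moreover have "(\<integral>\<^sup>+z\<in>- ball 0 \<delta>. ennreal (min 1 (norm z powr 0)) \<partial>\<nu> x)
      = (\<integral>\<^sup>+z. indicator (- ball 0 \<delta>) z \<partial>\<nu> x)"
    using assms(3) by (intro nn_integral_cong) (auto simp: indicator_def)
  ultimately show ?thesis
    using assms by (simp add: h_fun_def)
qed

text \<open>This is the case \<beta> = 1, admissible since \<sigma> < 1: short jumps have a finite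
  first moment, so Lipschitz growth is integrable.\<close>

lemma M2_core:
  assumes "M2 \<Omega> \<nu> \<sigma> C2" "\<sigma> < 1" "0 < \<delta>" "\<delta> < 1" "x \<in> closure \<Omega>"
  shows "(\<integral>\<^sup>+z\<in>ball 0 \<delta>. ennreal (norm z) \<partial>\<nu> x) \<le> ennreal (C2 * \<delta> powr (1 - \<sigma>))"
proof -
  have "(SUP x\<in>closure \<Omega>. \<integral>\<^sup>+z\<in>ball 0 \<delta>. ennreal (norm z powr 1) \<partial>\<nu> x) \<le> ennreal (C2 * \<delta> powr (1 - \<sigma>))"
    using assms(1)[unfolded M2_def, THEN bspec[of _ _ 1], THEN bspec[of _ _ \<delta>]] assms(2-4) by simp
  then have "(\<integral>\<^sup>+z\<in>ball 0 \<delta>. ennreal (norm z powr 1) \<partial>\<nu> x) \<le> ennreal (C2 * \<delta> powr (1 - \<sigma>))"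
    by (rule order_trans[OF SUP_upper[OF assms(5)]])
  then show ?thesis by simp
qed

section \<open>Local defining functions of a domain with C1 boundary\<close>

text \<open>A defining function with nearly constant gradient. The centre \<open>p\<close> need not
  lie on the frontier, so interior and boundary points are handled alike. The tolerance 1/8 is what
  later yields an angle bound of 1/4.\<close>

definition level_chart ::
  "'a::euclidean_space set \<Rightarrow> 'a \<Rightarrow> real \<Rightarrow> ('a \<Rightarrow> real) \<Rightarrow> ('a \<Rightarrow> 'a) \<Rightarrow> bool" where
  "level_chart \<Omega> p r \<rho> G \<longleftrightarrow>
     r > 0 \<and> C1_gradient_on \<rho> G UNIV \<and> (\<forall>y. 1 \<le> norm (G y)) \<and>
     (\<forall>y\<in>ball p r. norm (G y - G p) \<le> 1/8) \<and>
     (\<forall>y\<in>ball p r. y \<in> \<Omega> \<longleftrightarrow> 0 < \<rho> y)"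

text \<open>The height above the graph serves as \<rho>. Its gradient has component 1 along
  \<open>e\<close>, hence norm at least 1; continuity of the gradient permits shrinking the radius
  until the tolerance holds.\<close>

lemma level_chart_graph:
  fixes \<Omega> :: "'a::euclidean_space set"
  assumes "r > 0" "norm e = 1" "C1_on \<gamma> UNIV"
    and sup: "\<Omega> \<inter> ball p r = {x \<in> ball p r. x \<bullet> e > \<gamma> (x - (x \<bullet> e) *\<^sub>R e)}"
  shows "\<exists>r' \<rho> G. level_chart \<Omega> p r' \<rho> G"
proof -
  obtain H where contH: "continuous_on UNIV H"
    and derH: "\<And>x. (\<gamma> has_derivative (\<lambda>h. H x \<bullet> h)) (at x)"
    using assms(3) unfolding C1_on_def C1_gradient_on_def by auto
  define \<pi> where "\<pi> x = x - (x \<bullet> e) *\<^sub>R e" for x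
  define \<rho> where "\<rho> x = x \<bullet> e - \<gamma> (\<pi> x)" for x
  \<comment> \<open>The projection \<pi> is self-adjoint, so it reappears around the gradient of
    \<gamma>.\<close>
  define G where "G x = e - \<pi> (H (\<pi> x))" for x
  have ee: "e \<bullet> e = 1" using assms(2) by (simp add: dot_square_norm)
  have der: "(\<rho> has_derivative (\<lambda>h. G x \<bullet> h)) (at x)" for x
  proof -
    have "bounded_linear \<pi>"
      unfolding \<pi>_def
      by (intro bounded_linear_sub bounded_linear_ident
          bounded_linear_scaleR_const bounded_linear_inner_left)
    then have "(\<pi> has_derivative \<pi>) (at x)" by (rule bounded_linear_imp_has_derivative)
    then have "((\<gamma> \<circ> \<pi>) has_derivative ((\<lambda>h. H (\<pi> x) \<bullet> h) \<circ> \<pi>)) (at x)"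
      by (intro diff_chain_at derH)
    then have "(\<rho> has_derivative (\<lambda>h. h \<bullet> e - H (\<pi> x) \<bullet> \<pi> h)) (at x)"
      unfolding \<rho>_def o_def
      by (intro has_derivative_diff bounded_linear_imp_has_derivative bounded_linear_inner_left)
    moreover have "h \<bullet> e - H (\<pi> x) \<bullet> \<pi> h = G x \<bullet> h" for h
      unfolding G_def \<pi>_def by (simp add: inner_diff_left inner_diff_right inner_commute)
    ultimately show ?thesis by simp
  qed
  have contG: "continuous_on UNIV G"
    unfolding G_def \<pi>_def
    by (intro continuous_intros continuous_on_compose2[OF contH]) auto
  have norm_G: "1 \<le> norm (G x)" for x
  proof -
    have "G x \<bullet> e = 1" unfolding G_def \<pi>_def by (simp add: inner_diff_left ee)
    then show ?thesis using Cauchy_Schwarz_ineq2[of "G x" e] assms(2) by simp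
  qed
  have "\<exists>d>0. \<forall>y. dist y p < d \<longrightarrow> dist (G y) (G p) < 1/8"
    using contG[unfolded continuous_on_iff, rule_format, of p "1/8"] by auto
  then obtain d where d: "d > 0" "\<And>y. dist y p < d \<Longrightarrow> dist (G y) (G p) < 1/8" by blast
  have "y \<in> \<Omega> \<longleftrightarrow> 0 < \<rho> y" if "y \<in> ball p (min r d)" for y
  proof -
    have "y \<in> ball p r" using that by simp
    then have "y \<in> \<Omega> \<longleftrightarrow> y \<in> \<Omega> \<inter> ball p r" by blast
    also have "\<dots> \<longleftrightarrow> 0 < \<rho> y"
      unfolding sup \<rho>_def \<pi>_def using \<open>y \<in> ball p r\<close> by simp
    finally show ?thesis .
  qed
  moreover have "norm (G y - G p) \<le> 1/8" if "y \<in> ball p (min r d)" for y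
  proof -
    have "dist (G y) (G p) < 1/8" using that by (intro d(2)) (simp add: dist_commute)
    then show ?thesis by (simp add: dist_norm)
  qed
  ultimately have "level_chart \<Omega> p (min r d) \<rho> G"
    unfolding level_chart_def C1_gradient_on_def using assms(1) d(1) der contG norm_G by simp
  then show ?thesis by (intro exI)
qed

lemma level_chart_exists:
  fixes \<Omega> :: "'a::euclidean_space set"
  assumes "open \<Omega>" "C1_boundary \<Omega>" "p \<in> closure \<Omega>"
  shows "\<exists>r \<rho> G. level_chart \<Omega> p r \<rho> G"
proof (cases "p \<in> \<Omega>")
  case True
  then obtain r where r: "r > 0" "ball p r \<subseteq> \<Omega>" using assms(1) openE by blast
  obtain e :: 'a where e: "norm e = 1" using vector_choose_size[of 1] by auto
  \<comment> \<open>A constant graph lying below the whole ball makes an interior point fit the same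
    form.\<close>
  define \<gamma> where "\<gamma> = (\<lambda>_::'a. p \<bullet> e - r)"
  have "C1_on \<gamma> UNIV"
    unfolding C1_on_def C1_gradient_on_def \<gamma>_def
    by (intro exI[of _ "\<lambda>_. 0"]) (auto intro!: derivative_eq_intros)
  moreover have "\<gamma> (x - (x \<bullet> e) *\<^sub>R e) < x \<bullet> e" if "x \<in> ball p r" for x
    using that Cauchy_Schwarz_ineq2[of "p - x" e] e
    by (simp add: \<gamma>_def dist_norm inner_diff_left)
  then have "\<Omega> \<inter> ball p r = {x \<in> ball p r. x \<bullet> e > \<gamma> (x - (x \<bullet> e) *\<^sub>R e)}"
    using r by auto
  ultimately show ?thesis using level_chart_graph r e by blast
next
  case False
  then have "p \<in> frontier \<Omega>" using assms by (simp add: frontier_def interior_open)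
  then obtain r e \<gamma> where "r > 0" "norm e = 1" "C1_on \<gamma> UNIV"
    "\<Omega> \<inter> ball p r = {x \<in> ball p r. x \<bullet> e > \<gamma> (x - (x \<bullet> e) *\<^sub>R e)}"
    using assms(2) unfolding C1_boundary_def by meson
  then show ?thesis using level_chart_graph by blast
qed

section \<open>First-order estimates inside a chart\<close>

context
  fixes \<Omega> :: "'a::euclidean_space set" and p r \<rho> G
  assumes chart: "level_chart \<Omega> p r \<rho> G"
begin

lemma level_chart_derivative: "(\<rho> has_derivative (\<lambda>h. G y \<bullet> h)) (at y)"
  using chart unfolding level_chart_def C1_gradient_on_def by simp

lemma level_chart_continuous: "continuous_on S \<rho>" "continuous_on S G"
proof -
  show "continuous_on S \<rho>"
    by (rule has_derivative_continuous_on[OF has_derivative_at_withinI[OF level_chart_derivative]])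
  show "continuous_on S G"
    using chart continuous_on_subset[of UNIV G S] unfolding level_chart_def C1_gradient_on_def
    by simp
qed

text \<open>Mean value inequality for \<rho> minus its linear part at \<open>p\<close>, whose
  gradient is at most 1/8 on the ball.\<close>

lemma level_chart_linear:
  assumes "x \<in> ball p r" "y \<in> ball p r"
  shows "\<bar>\<rho> y - \<rho> x - G p \<bullet> (y - x)\<bar> \<le> norm (y - x) / 8"
proof -
  define f where "f z = \<rho> z - G p \<bullet> z" for z
  have "norm (f y - f x) \<le> 1/8 * norm (y - x)"
  proof (rule differentiable_bound[OF convex_ball _ _ assms(2,1)])
    fix z assume z: "z \<in> ball p r"
    show "(f has_derivative (\<lambda>h. (G z - G p) \<bullet> h)) (at z within ball p r)"
      unfolding f_def using level_chart_derivative[of z, THEN has_derivative_at_withinI]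
      by (auto intro!: derivative_eq_intros simp: inner_diff_left)
    have "norm (G z - G p) \<le> 1/8" using chart z unfolding level_chart_def by blast
    then have "\<bar>(G z - G p) \<bullet> h\<bar> \<le> 1/8 * norm h" for h
      by (intro order_trans[OF Cauchy_Schwarz_ineq2] mult_right_mono) auto
    then show "onorm (\<lambda>h. (G z - G p) \<bullet> h) \<le> 1/8"
      by (intro onorm_bound) auto
  qed
  then show ?thesis unfolding f_def by (simp add: inner_diff_right algebra_simps)
qed

lemma level_chart_lipschitz:
  assumes "x \<in> ball p r" "y \<in> ball p r"
  shows "\<bar>\<rho> y - \<rho> x\<bar> \<le> (norm (G p) + 1) * norm (y - x)"
  using level_chart_linear[OF assms] Cauchy_Schwarz_ineq2[of "G p" "y - x"]
    norm_ge_zero[of "y - x"]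
  unfolding distrib_right by linarith

text \<open>One eighth comes from linearizing \<rho>, another from replacing \<open>G p\<close> by
  \<open>G y\<close>. If \<open>y\<close> is no deeper than \<open>x\<close>, the gradient hardly
  points along \<open>y - x\<close>.\<close>

lemma level_chart_gradient_inner:
  assumes "x \<in> ball p r" "y \<in> ball p r"
  shows "G y \<bullet> (y - x) \<le> \<rho> y - \<rho> x + norm (y - x) / 4"
proof -
  have "\<bar>(G y - G p) \<bullet> (y - x)\<bar> \<le> norm (G y - G p) * norm (y - x)"
    by (rule Cauchy_Schwarz_ineq2)
  also have "\<dots> \<le> 1/8 * norm (y - x)"
    using chart assms(2) unfolding level_chart_def by (intro mult_right_mono) auto
  finally show ?thesis
    using level_chart_linear[OF assms] unfolding inner_diff_left by linarith
qed

lemma level_chart_norm_gradient: "y \<in> ball p r \<Longrightarrow> norm (G y) \<le> norm (G p) + 1"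
  using chart[unfolded level_chart_def] norm_triangle_sub[of "G y" "G p"] by force

end

text \<open>Moving against \<open>G p\<close> lowers \<rho> by at least 7/8 of the distance, to a
  negative value. The set where \<rho> is negative is open and misses \<Omega> in the ball, so it
  misses the closure too.\<close>

lemma level_chart_outward:
  fixes \<Omega> :: "'a::euclidean_space set"
  assumes chart: "level_chart \<Omega> p r \<rho> G" and "open \<Omega>"
    and q: "q \<in> frontier \<Omega>" "q \<in> ball p (r/2)" and t: "0 < t" "t * norm (G p) < r / 2"
  shows "q - t *\<^sub>R G p \<notin> closure \<Omega>"
proof
  assume cl: "q - t *\<^sub>R G p \<in> closure \<Omega>"
  have r: "r > 0" and G: "1 \<le> norm (G p)"
    and \<Omega>: "\<And>y. y \<in> ball p r \<Longrightarrow> y \<in> \<Omega> \<longleftrightarrow> 0 < \<rho> y"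
    using chart unfolding level_chart_def by blast+
  let ?q = "q - t *\<^sub>R G p"
  have q1: "q \<in> ball p r" using q(2) r by simp
  have "dist p ?q \<le> dist p q + dist q ?q" by (rule dist_triangle)
  then have q2: "?q \<in> ball p r" using q(2) t r by (simp add: dist_norm)
  have "q \<notin> \<Omega>" using q(1) assms(2) by (simp add: frontier_def interior_open)
  then have "\<rho> q \<le> 0" using \<Omega> q1 by force
  moreover have "\<rho> ?q - \<rho> q + t * (norm (G p))^2 \<le> t * norm (G p) / 8"
    using abs_le_D1[OF level_chart_linear[OF chart q1 q2]] t(1) by (simp add: dot_square_norm)
  moreover have "t * norm (G p) \<le> t * (norm (G p))^2"
    using G t(1) self_le_power[of "norm (G p)" 2] by (intro mult_left_mono) auto
  moreover have "0 < t * norm (G p)" using G t(1) by (intro mult_pos_pos) auto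
  ultimately have neg: "\<rho> ?q < 0" by linarith
  have "open ({y. \<rho> y < 0} \<inter> ball p r)"
    using level_chart_continuous(1)[OF chart, of UNIV]
    by (intro open_Int open_Collect_less) auto
  moreover have "({y. \<rho> y < 0} \<inter> ball p r) \<inter> \<Omega> = {}" using \<Omega> by auto
  ultimately have "({y. \<rho> y < 0} \<inter> ball p r) \<inter> closure \<Omega> = {}"
    by (simp add: open_Int_closure_eq_empty)
  then show False using neg q2 cl by blast
qed

section \<open>Localizing viscosity test functions\<close>

lemma C1_gradient_on_subset:
  "C1_gradient_on f G S \<Longrightarrow> T \<subseteq> S \<Longrightarrow> C1_gradient_on f G T"
  unfolding C1_gradient_on_def by (meson continuous_on_subset has_derivative_subset subsetD)

text \<open>Squaring smooths the kink at 0, which makes the cutoff below continuously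
  differentiable.\<close>

lemma has_real_derivative_max0_square:
  "((\<lambda>s. (max 0 s)\<^sup>2) has_real_derivative 2 * max 0 s) (at s)"
proof -
  consider "s > 0" | "s < 0" | "s = 0" by linarith
  then show ?thesis
  proof cases
    case 1
    have "((\<lambda>s. s\<^sup>2) has_real_derivative 2 * s) (at s)" by (auto intro!: derivative_eq_intros)
    moreover have "eventually (\<lambda>t::real. t > 0) (nhds s)" using 1 by (rule eventually_nhds_in_open[OF open_greaterThan, simplified])
    then have "eventually (\<lambda>t. (max 0 t)\<^sup>2 = t\<^sup>2) (nhds s)" by eventually_elim auto
    ultimately show ?thesis using 1 by (subst DERIV_cong_ev[OF refl _ refl]) auto
  next
    case 2
    have "eventually (\<lambda>t::real. t < 0) (nhds s)" using 2 by (rule eventually_nhds_in_open[OF open_lessThan, simplified])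
    then have "eventually (\<lambda>t. (max 0 t)\<^sup>2 = 0) (nhds s)" by eventually_elim auto
    then show ?thesis using 2 by (subst DERIV_cong_ev[OF refl _ refl, of _ "\<lambda>_. 0"]) auto
  next
    case 3
    have "((\<lambda>h::real. (max 0 h)\<^sup>2 / h) \<longlongrightarrow> 0) (at 0)"
    proof (rule Lim_null_comparison)
      show "\<forall>\<^sub>F h::real in at 0. norm ((max 0 h)\<^sup>2 / h) \<le> \<bar>h\<bar>"
        by (rule always_eventually) (auto simp: max_def power2_eq_square)
    qed (auto intro!: tendsto_eq_intros)
    then show ?thesis using 3 by (simp add: DERIV_def)
  qed
qed

text \<open>
  Viscosity test functions must be \<open>C\<^sup>1\<close> on the whole closure and touch globally; multiplying
  by a cutoff and adding a large constant reduces this to a local condition.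
\<close>

lemma extend_test_function:
  fixes u \<phi>0 :: "'a::euclidean_space \<Rightarrow> real"
  assumes "bdd_above (u ` S)" "open V" "0 < r" "cball y0 r \<subseteq> V" "cball y0 r \<subseteq> S"
    and grad: "C1_gradient_on \<phi>0 G0 V"
    and max: "\<And>y. y \<in> cball y0 r \<Longrightarrow> u y - \<phi>0 y \<le> u y0 - \<phi>0 y0"
  shows "\<exists>\<phi> D\<phi>. C1_gradient_on \<phi> D\<phi> UNIV \<and> D\<phi> y0 = G0 y0 \<and>
    (\<forall>y\<in>S. u y - \<phi> y \<le> u y0 - \<phi> y0)"
proof -
  obtain B where B: "\<And>y. y \<in> S \<Longrightarrow> u y \<le> B" using assms(1) unfolding bdd_above_def by auto
  \<comment> \<open>Chosen so that the constant \<open>K\<close> already lies above \<open>u\<close>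
    by the required margin on all of \<open>S\<close>.\<close>
  define K where "K = B - (u y0 - \<phi>0 y0)"
  \<comment> \<open>Positive exactly inside the ball and equal to 1 at \<open>y0\<close>, so \<eta>
    is a cutoff with value 1 and gradient 0 there.\<close>
  define q where "q y = 1 - (norm (y - y0))\<^sup>2 / r\<^sup>2" for y
  define \<eta> where "\<eta> y = (max 0 (q y))\<^sup>2" for y
  define D where "D y = (- 4 / r\<^sup>2 * max 0 (q y)) *\<^sub>R (y - y0)" for y
  define \<phi> where "\<phi> y = (if y \<in> V then \<eta> y * \<phi>0 y + (1 - \<eta> y) * K else K)" for y
  define D\<phi> where "D\<phi> y = (if y \<in> V then \<eta> y *\<^sub>R G0 y + (\<phi>0 y - K) *\<^sub>R D y else 0)" for y
  have q0: "q y0 = 1" by (simp add: q_def)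
  have q_le: "q y \<le> 1" for y by (simp add: q_def)
  have q_neg: "q y < 0" if "y \<notin> cball y0 r" for y
  proof -
    have "r\<^sup>2 < (norm (y - y0))\<^sup>2"
      using that assms(3) by (intro power_strict_mono) (auto simp: dist_norm norm_minus_commute)
    then show ?thesis using assms(3) by (simp add: q_def field_simps)
  qed
  have derq: "(q has_derivative (\<lambda>h. - 2 / r\<^sup>2 * ((y - y0) \<bullet> h))) (at y)" for y
  proof -
    define c where "c = 1 / r\<^sup>2"
    have "((\<lambda>y. 1 - c * ((y - y0) \<bullet> (y - y0))) has_derivative
        (\<lambda>h. - 2 * c * ((y - y0) \<bullet> h))) (at y)"
      by (auto intro!: derivative_eq_intros simp: inner_commute)
    moreover have "q = (\<lambda>y. 1 - c * ((y - y0) \<bullet> (y - y0)))"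
      by (simp add: fun_eq_iff q_def power2_norm_eq_inner c_def)
    ultimately show ?thesis by (simp add: c_def)
  qed
  have der\<eta>: "(\<eta> has_derivative (\<lambda>h. D y \<bullet> h)) (at y)" for y
  proof -
    have "(\<eta> has_derivative (\<lambda>h. 2 * max 0 (q y) * (- 2 / r\<^sup>2 * ((y - y0) \<bullet> h)))) (at y)"
      unfolding \<eta>_def
      using has_derivative_compose[OF derq has_real_derivative_max0_square[unfolded has_field_derivative_def]]
      by simp
    moreover have "2 * max 0 (q y) * (- 2 / r\<^sup>2 * ((y - y0) \<bullet> h)) = D y \<bullet> h" for h
      by (simp add: D_def)
    ultimately show ?thesis by simp
  qed
  have contq: "continuous_on A q" for A
    using has_derivative_continuous_on[OF has_derivative_at_withinI[OF derq]] .
  have cont\<eta>: "continuous_on A \<eta>" for A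
    using has_derivative_continuous_on[OF has_derivative_at_withinI[OF der\<eta>]] .
  have contD: "continuous_on A D" for A
    unfolding D_def by (intro continuous_intros contq)
  have cont\<phi>0: "continuous_on V \<phi>0"
    using grad has_derivative_continuous_on[of V \<phi>0 "\<lambda>y h. G0 y \<bullet> h"]
    unfolding C1_gradient_on_def by blast
  let ?W = "- cball y0 r"
  have UNIV: "UNIV = V \<union> ?W" using assms(4) by auto
  have W: "\<phi> y = K" "D\<phi> y = 0" if "y \<in> ?W" for y
    using q_neg[of y] that by (auto simp: \<phi>_def D\<phi>_def \<eta>_def D_def)
  have "continuous_on V D\<phi>"
  proof (rule continuous_on_eq)
    show "continuous_on V (\<lambda>y. \<eta> y *\<^sub>R G0 y + (\<phi>0 y - K) *\<^sub>R D y)"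
      using grad unfolding C1_gradient_on_def by (intro continuous_intros cont\<eta> contD cont\<phi>0) auto
  qed (simp add: D\<phi>_def)
  moreover have "continuous_on ?W D\<phi>"
    by (rule continuous_on_eq[of _ "\<lambda>_. 0"]) (auto simp: W)
  ultimately have cont: "continuous_on UNIV D\<phi>"
    unfolding UNIV using assms(2) by (intro continuous_on_open_Un) auto
  have der: "(\<phi> has_derivative (\<lambda>h. D\<phi> y \<bullet> h)) (at y)" for y
  proof (cases "y \<in> V")
    case True
    have "(\<phi>0 has_derivative (\<lambda>h. G0 y \<bullet> h)) (at y)"
      using grad True assms(2) at_within_open[OF True] unfolding C1_gradient_on_def by metis
    then have "((\<lambda>y. \<eta> y * \<phi>0 y + (1 - \<eta> y) * K) has_derivative (\<lambda>h. D\<phi> y \<bullet> h)) (at y)"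
      using True
      by (auto intro!: derivative_eq_intros der\<eta> simp: D\<phi>_def inner_add_left algebra_simps)
    then show ?thesis
      by (rule has_derivative_transform_within_open[OF _ assms(2) True]) (simp add: \<phi>_def)
  next
    case False
    then have y: "y \<in> ?W" using assms(4) by auto
    have "((\<lambda>_. K) has_derivative (\<lambda>h. D\<phi> y \<bullet> h)) (at y)" using W(2)[OF y] by simp
    then show ?thesis
      by (rule has_derivative_transform_within_open[OF _ open_Compl[OF closed_cball] y])
        (simp add: W)
  qed
  have touch: "u y - \<phi> y \<le> u y0 - \<phi> y0" if y: "y \<in> S" for y
  proof -
    have y0: "y0 \<in> V" using assms(3,4) by auto
    have "\<phi> y0 = \<phi>0 y0" using y0 q0 by (simp add: \<phi>_def \<eta>_def)
    moreover have uK: "u y - K \<le> u y0 - \<phi>0 y0" using B[OF y] by (simp add: K_def)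
    moreover have "u y - \<phi> y \<le> u y0 - \<phi>0 y0"
    proof (cases "y \<in> cball y0 r")
      case True
      have \<eta>: "0 \<le> \<eta> y" "\<eta> y \<le> 1" using q_le[of y] by (auto simp: \<eta>_def power_le_one)
      \<comment> \<open>A convex combination of two quantities, each at most
        \<open>u y0 - \<phi>0 y0\<close>.\<close>
      have "u y - \<phi> y = \<eta> y * (u y - \<phi>0 y) + (1 - \<eta> y) * (u y - K)"
        using True assms(4) by (auto simp: \<phi>_def algebra_simps)
      also have "\<dots> \<le> \<eta> y * (u y0 - \<phi>0 y0) + (1 - \<eta> y) * (u y0 - \<phi>0 y0)"
        using \<eta> max[OF True] uK by (intro add_mono mult_left_mono) auto
      finally show ?thesis by (simp add: algebra_simps)
    next
      case False
      then show ?thesis using W(1)[of y] uK by simp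
    qed
    ultimately show ?thesis by simp
  qed
  have "D\<phi> y0 = G0 y0"
    using subsetD[OF assms(4), of y0] assms(3) q0 by (simp add: D\<phi>_def \<eta>_def D_def)
  then show ?thesis
    using cont der touch unfolding C1_gradient_on_def by (intro exI[of _ \<phi>] exI[of _ D\<phi>]) auto
qed

section \<open>The operator does not see the frontier\<close>

locale nonlocal_operator =
  fixes \<Omega> :: "'a::euclidean_space set" and \<nu> :: "'a \<Rightarrow> 'a measure" and \<sigma> C1 C2 :: real
  assumes bounded_domain: "bounded \<Omega>" and open_domain: "open \<Omega>"
    and C1_boundary_domain: "C1_boundary \<Omega>"
    and \<sigma>: "0 < \<sigma>" "\<sigma> < 1" and C1_pos: "0 < C1" and C2_pos: "0 < C2"
    and sets_borel: "\<And>x. x \<in> closure \<Omega> \<Longrightarrow> sets (\<nu> x) = sets borel"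
    and M0: "M0 \<Omega> \<nu>" and M1: "M1 \<Omega> \<nu> \<sigma> C1" and M2: "M2 \<Omega> \<nu> \<sigma> C2"
begin

lemma in_closure: "x \<in> \<Omega> \<Longrightarrow> x \<in> closure \<Omega>"
  using closure_subset by blast

lemma tail_integral:
  assumes "x \<in> \<Omega>" "0 < \<delta>"
  shows "integrable (\<nu> x) (indicator (- ball 0 \<delta>) :: 'a \<Rightarrow> real)"
    and "(LINT z|\<nu> x. indicator (- ball 0 \<delta>) z) \<le> C1 * \<delta> powr (- \<sigma>)"
proof -
  note x = in_closure[OF assms(1)]
  have "emeasure (\<nu> x) (- ball 0 \<delta>) \<le> ennreal (C1 * \<delta> powr (- \<sigma>))"
    using M1_tail[OF M1 \<sigma>(1) assms(2) x sets_borel[OF x]] .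
  moreover from this have "emeasure (\<nu> x) (- ball 0 \<delta>) < \<infinity>"
    using ennreal_less_top order_le_less_trans by (metis infinity_ennreal_def)
  moreover have space: "space (\<nu> x) = UNIV"
    using sets_eq_imp_space_eq[OF sets_borel[OF x]] by simp
  moreover have "- ball 0 \<delta> \<in> sets (\<nu> x)" using sets_borel[OF x] by simp
  ultimately show "integrable (\<nu> x) (indicator (- ball 0 \<delta>) :: 'a \<Rightarrow> real)"
    "(LINT z|\<nu> x. indicator (- ball 0 \<delta>) z) \<le> C1 * \<delta> powr (- \<sigma>)"
    using C1_pos by (auto simp: measure_def intro!: enn2real_leI)
qed

lemma core_integral:
  assumes "x \<in> \<Omega>" "0 < \<delta>" "\<delta> < 1"
  shows "integrable (\<nu> x) (\<lambda>z. norm z * indicator (ball 0 \<delta>) z)"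
    and "(LINT z|\<nu> x. norm z * indicator (ball 0 \<delta>) z) \<le> C2 * \<delta> powr (1 - \<sigma>)"
proof -
  note x = in_closure[OF assms(1)]
  have nn: "(\<integral>\<^sup>+z. ennreal (norm z * indicator (ball 0 \<delta>) z) \<partial>\<nu> x) \<le> ennreal (C2 * \<delta> powr (1 - \<sigma>))"
    using M2_core[OF M2 \<sigma>(2) assms(2,3) x] by (simp add: ennreal_mult ennreal_indicator)
  have meas: "(\<lambda>z. norm z * indicator (ball 0 \<delta>) z) \<in> borel_measurable (\<nu> x)"
    unfolding measurable_cong_sets[OF sets_borel[OF x] refl]
    by (intro borel_measurable_times borel_measurable_indicator) auto
  show int: "integrable (\<nu> x) (\<lambda>z. norm z * indicator (ball 0 \<delta>) z)"
    using nn meas by (intro integrableI_nonneg) (auto intro: order_le_less_trans)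
  have "ennreal (LINT z|\<nu> x. norm z * indicator (ball 0 \<delta>) z) \<le> ennreal (C2 * \<delta> powr (1 - \<sigma>))"
    using nn nn_integral_eq_integral[OF int] by simp
  then show "(LINT z|\<nu> x. norm z * indicator (ball 0 \<delta>) z) \<le> C2 * \<delta> powr (1 - \<sigma>)"
    using C2_pos by (subst (asm) ennreal_le_iff) auto
qed

text \<open>
  The values of a subsolution on the frontier are not controlled by the equation, so it matters
  that jumps from the interior do not land there. The set \<open>D\<close> of jumps from \<open>x\<close> to a piece of the
  frontier is missed by all jumps from \<open>x - t *\<^sub>R G p\<close>, and M0 makes its mass continuous in \<open>x\<close>.
\<close>

lemma AE_not_frontier:
  assumes x: "x \<in> \<Omega>"
  shows "AE z in \<nu> x. x + z \<notin> frontier \<Omega>"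
proof -
  note xc = in_closure[OF x]
  obtain d where d: "0 < d" "ball x d \<subseteq> \<Omega>" using open_domain x openE by blast
  have away: "q \<notin> ball x d" if "q \<in> frontier \<Omega>" for q
    using that d(2) open_domain by (auto simp: frontier_def interior_open)
  have piece: "\<exists>\<epsilon>>0. {z. x + z \<in> frontier \<Omega> \<inter> ball p \<epsilon>} \<in> null_sets (\<nu> x)"
    if p: "p \<in> frontier \<Omega>" for p
  proof -
    have "p \<in> closure \<Omega>" using p by (simp add: frontier_def)
    then obtain r \<rho> G where chart: "level_chart \<Omega> p r \<rho> G"
      using level_chart_exists[OF open_domain C1_boundary_domain] by blast
    then have r: "0 < r" unfolding level_chart_def by simp
    define D where "D = {z. x + z \<in> frontier \<Omega> \<inter> ball p (r/2)}"
    \<comment> \<open>Vanishing near \<open>x\<close> makes \<open>w\<close> admissible in M0, while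
      \<open>w\<close> is 1 on the whole frontier: its operator over \<open>D\<close> at
      \<open>x\<close> will be the mass of \<open>D\<close>.\<close>
    define w where "w = (indicator (- ball x d) :: 'a \<Rightarrow> real)"
    have "D = (\<lambda>z. x + z) -` (frontier \<Omega> \<inter> ball p (r/2)) \<inter> space borel" by (auto simp: D_def)
    also have "\<dots> \<in> sets borel" by (rule measurable_sets[of _ borel borel]) auto
    finally have D: "D \<in> sets borel" .
    have w: "w y = 0" if "y \<in> ball x d" for y using that by (simp add: w_def)
    have "C1_gradient_on w (\<lambda>_. 0) (ball x d \<inter> closure \<Omega>)"
      unfolding C1_gradient_on_def
    proof (intro conjI ballI)
      fix y assume y: "y \<in> ball x d \<inter> closure \<Omega>"
      have "((\<lambda>_. 0) has_derivative (\<lambda>h. 0 \<bullet> h)) (at y within ball x d \<inter> closure \<Omega>)" by simp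
      then show "(w has_derivative (\<lambda>h. 0 \<bullet> h)) (at y within ball x d \<inter> closure \<Omega>)"
        by (rule has_derivative_transform[OF y, rotated]) (simp add: w)
    qed simp
    then have "C1_on w (ball x d \<inter> closure \<Omega>)" unfolding C1_on_def by blast
    moreover have "w \<in> borel_measurable (restrict_space borel (closure \<Omega>))"
      unfolding w_def by (intro measurable_restrict_space1 borel_measurable_indicator) auto
    moreover have "bounded (w ` closure \<Omega>)"
      by (rule boundedI[of _ 1]) (auto simp: w_def indicator_def)
    ultimately have cont: "continuous_on (ball x d \<inter> closure \<Omega>) (\<lambda>y. nl_op \<Omega> \<nu> D w y)"
      using M0 xc d(1) D unfolding M0_def by blast
    \<comment> \<open>Small enough that the shifted points stay in \<open>ball x d\<close> and the
      shift meets the size condition of \<open>level_chart_outward\<close>.\<close>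
    define c where "c = min d (r/2) / (norm (G p) + 1)"
    have c: "0 < c" "c * norm (G p) < min d (r/2)"
    proof -
      have pos: "0 < norm (G p) + 1" by (intro add_nonneg_pos) auto
      show "0 < c" using d(1) r pos unfolding c_def by (intro divide_pos_pos) auto
      moreover have "c * (norm (G p) + 1) = min d (r/2)" using pos by (simp add: c_def)
      ultimately show "c * norm (G p) < min d (r/2)"
        unfolding distrib_left by linarith
    qed
    define t where "t n = c * inverse (real (Suc n))" for n
    have t0: "0 < t n" for n using c(1) by (simp add: t_def)
    have "t n \<le> c * 1" for n
      unfolding t_def using c(1) by (intro mult_left_mono) (auto simp: field_simps)
    then have "t n * norm (G p) \<le> c * norm (G p)" for n by (intro mult_right_mono) auto
    then have t1: "t n * norm (G p) < min d (r/2)" for n using c(2) by (rule le_less_trans)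
    have tlim: "t \<longlonglongrightarrow> 0"
      unfolding t_def using tendsto_mult_right_zero[OF LIMSEQ_inverse_real_of_nat] .
    define y where "y n = x - t n *\<^sub>R G p" for n
    have y: "y n \<in> ball x d \<inter> closure \<Omega>" for n
    proof -
      have "y n \<in> ball x d" using t1[of n] t0[of n] by (simp add: y_def dist_norm)
      then show ?thesis using d(2) in_closure by blast
    qed
    have ylim: "y \<longlonglongrightarrow> x"
      unfolding y_def using tlim by (auto intro!: tendsto_eq_intros)
    have "nl_op \<Omega> \<nu> D w (y n) = 0" for n
    proof -
      \<comment> \<open>A jump in \<open>D\<close> from \<open>y n\<close> lands at a frontier point
        pushed outward by \<open>t n *\<^sub>R G p\<close>.\<close>
      have "nl_domain \<Omega> D (y n) = {}"
      proof -
        have "y n + z \<notin> closure \<Omega>" if "z \<in> D" for z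
          using level_chart_outward[OF chart open_domain, of "x + z" "t n"] that t0[of n] t1[of n]
          by (simp add: D_def y_def algebra_simps)
        then show ?thesis by (auto simp: nl_domain_def)
      qed
      then show ?thesis by (simp add: nl_op_def set_lebesgue_integral_def)
    qed
    moreover have "(\<lambda>n. nl_op \<Omega> \<nu> D w (y n)) \<longlonglongrightarrow> nl_op \<Omega> \<nu> D w x"
      using continuous_on_tendsto_compose[OF cont ylim] y xc d(1) by simp
    ultimately have "nl_op \<Omega> \<nu> D w x = 0" by (simp add: LIMSEQ_const_iff)
    moreover have "nl_domain \<Omega> D x = D" by (auto simp: nl_domain_def D_def frontier_def)
    moreover have "(\<lambda>z. indicator D z *\<^sub>R (w (x + z) - w x)) = (indicator D :: 'a \<Rightarrow> real)"
      using away d(1) by (auto simp: D_def w_def indicator_def fun_eq_iff)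
    ultimately have "(LINT z|\<nu> x. (indicator D z :: real)) = 0"
      unfolding nl_op_def set_lebesgue_integral_def by metis
    moreover have "D \<subseteq> - ball 0 d"
      using away by (force simp: D_def dist_norm)
    then have "integrable (\<nu> x) (indicator D :: 'a \<Rightarrow> real)"
      using D sets_borel[OF xc]
      by (intro Bochner_Integration.integrable_bound[OF tail_integral(1)[OF x d(1)]] AE_I2)
        (auto simp: indicator_def subset_iff intro!: borel_measurable_indicator[unfolded indicator_def])
    ultimately have "AE z in \<nu> x. (indicator D z :: real) = 0"
      by (subst (asm) integral_nonneg_eq_0_iff_AE) auto
    then have "AE z in \<nu> x. z \<notin> D" by (simp add: indicator_eq_0_iff)
    then have "D \<in> null_sets (\<nu> x)"
      using D sets_borel[OF xc] by (subst AE_iff_null_sets) auto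
    then show ?thesis using r unfolding D_def by (intro exI[of _ "r/2"]) simp
  qed
  then obtain \<epsilon> where \<epsilon>: "\<And>p. p \<in> frontier \<Omega> \<Longrightarrow> 0 < \<epsilon> p"
    "\<And>p. p \<in> frontier \<Omega> \<Longrightarrow> {z. x + z \<in> frontier \<Omega> \<inter> ball p (\<epsilon> p)} \<in> null_sets (\<nu> x)"
    by metis
  \<comment> \<open>Finitely many of the negligible pieces cover the frontier.\<close>
  have "compact (frontier \<Omega>)" using bounded_domain by (rule compact_frontier_bounded)
  moreover have "frontier \<Omega> \<subseteq> (\<Union>p\<in>frontier \<Omega>. ball p (\<epsilon> p))" using \<epsilon>(1) by auto
  ultimately obtain F where F: "F \<subseteq> frontier \<Omega>" "finite F" "frontier \<Omega> \<subseteq> (\<Union>p\<in>F. ball p (\<epsilon> p))"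
    using compactE_image[of "frontier \<Omega>" "frontier \<Omega>" "\<lambda>p. ball p (\<epsilon> p)"] by (metis open_ball)
  have "(\<Union>p\<in>F. {z. x + z \<in> frontier \<Omega> \<inter> ball p (\<epsilon> p)}) \<in> null_sets (\<nu> x)"
    using F(1,2) \<epsilon>(2) by (intro null_sets_UN') (auto intro: countable_finite)
  moreover have "{z \<in> space (\<nu> x). \<not> x + z \<notin> frontier \<Omega>}
      \<subseteq> (\<Union>p\<in>F. {z. x + z \<in> frontier \<Omega> \<inter> ball p (\<epsilon> p)})"
    using subsetD[OF F(3)] by fastforce
  ultimately show ?thesis by (rule AE_I')
qed

end

section \<open>The gradient estimate at a contact point\<close>

locale nonlocal_subsolution = nonlocal_operator \<Omega> \<nu> \<sigma> C1 C2
  for \<Omega> :: "'a::euclidean_space set" and \<nu> \<sigma> C1 C2 +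
  fixes m b0 A0 :: real and u :: "'a \<Rightarrow> real"
  assumes m: "\<sigma> < m" and b0: "0 < b0" and A0: "0 \<le> A0"
    and bounded_u: "bounded (u ` closure \<Omega>)"
    and subsolution: "viscosity_subsolution \<Omega> \<nu> m b0 A0 u"
begin

abbreviation R :: real where "R \<equiv> osc u (closure \<Omega>)"

lemma diff_le_R: "x \<in> closure \<Omega> \<Longrightarrow> y \<in> closure \<Omega> \<Longrightarrow> u x - u y \<le> R"
  by (rule diff_le_osc[OF bounded_u])

lemma R_nonneg: "x \<in> \<Omega> \<Longrightarrow> 0 \<le> R"
  using diff_le_R[of x x] in_closure by simp

lemma nl_op_ball_le:
  assumes y0: "y0 \<in> \<Omega>" and "0 < \<delta>" "\<delta> < 1" "0 \<le> C"
    and le: "\<And>z. norm z < \<delta> \<Longrightarrow> y0 + z \<in> closure \<Omega> \<Longrightarrow> \<phi> (y0 + z) - \<phi> y0 \<le> C * norm z"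
  shows "nl_op \<Omega> \<nu> (ball 0 \<delta>) \<phi> y0 \<le> C * (C2 * \<delta> powr (1 - \<sigma>))"
proof -
  have "nl_op \<Omega> \<nu> (ball 0 \<delta>) \<phi> y0 \<le> (LINT z|\<nu> y0. C * (norm z * indicator (ball 0 \<delta>) z))"
    unfolding nl_op_def set_lebesgue_integral_def
    using core_integral(1)[OF y0 assms(2,3)] assms(4) le
    by (intro integral_mono') (auto simp: indicator_def nl_domain_def)
  also have "\<dots> \<le> C * (C2 * \<delta> powr (1 - \<sigma>))"
    using core_integral(2)[OF y0 assms(2,3)] assms(4) by (auto intro: mult_left_mono)
  finally show ?thesis .
qed

text \<open>Jumps below \<tau> are charged to the first moment, the others to the oscillation times
  the tail mass. The bound is independent of \<delta>, so \<delta> can tend to 0 afterwards. Growth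
  of \<open>u\<close> is demanded only at points of \<Omega> because almost no jump reaches the
  frontier.\<close>

lemma nl_op_tail_le:
  assumes y0: "y0 \<in> \<Omega>" and "0 < \<tau>" "\<tau> < 1" "0 \<le> P"
    and le: "\<And>z. norm z < \<tau> \<Longrightarrow> y0 + z \<in> \<Omega> \<Longrightarrow> u (y0 + z) - u y0 \<le> P * norm z"
  shows "nl_op \<Omega> \<nu> (- ball 0 \<delta>) u y0 \<le> P * (C2 * \<tau> powr (1 - \<sigma>)) + R * (C1 * \<tau> powr (- \<sigma>))"
proof -
  let ?w = "\<lambda>z. P * (norm z * indicator (ball 0 \<tau>) z) + R * indicator (- ball 0 \<tau>) z"
  note core = core_integral[OF y0 assms(2,3)] and tail = tail_integral[OF y0 assms(2)]
  have R: "0 \<le> R" using R_nonneg y0 .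
  have "nl_op \<Omega> \<nu> (- ball 0 \<delta>) u y0 \<le> (LINT z|\<nu> y0. ?w z)"
    unfolding nl_op_def set_lebesgue_integral_def
  proof (rule integral_mono_AE')
    show "integrable (\<nu> y0) ?w" using core(1) tail(1) by simp
    show "AE z in \<nu> y0. 0 \<le> ?w z" using R assms(4) by (simp add: indicator_def)
    show "AE z in \<nu> y0. indicator (nl_domain \<Omega> (- ball 0 \<delta>) y0) z *\<^sub>R (u (y0 + z) - u y0) \<le> ?w z"
      using AE_not_frontier[OF y0]
    proof eventually_elim
      case (elim z)
      have w0: "0 \<le> ?w z" using R assms(4) by (simp add: indicator_def)
      show ?case
      proof (cases "z \<in> nl_domain \<Omega> (- ball 0 \<delta>) y0")
        case True
        then have z: "y0 + z \<in> closure \<Omega>" by (simp add: nl_domain_def)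
        with elim have "y0 + z \<in> \<Omega>" using open_domain by (auto simp: frontier_def interior_open)
        then have "u (y0 + z) - u y0 \<le> ?w z"
          using le[of z] diff_le_R[OF z in_closure[OF y0]] by (auto simp: indicator_def)
        then show ?thesis using True by simp
      qed (use w0 in simp)
    qed
  qed
  also have "\<dots> = P * (LINT z|\<nu> y0. norm z * indicator (ball 0 \<tau>) z) + R * (LINT z|\<nu> y0. indicator (- ball 0 \<tau>) z)"
    using core(1) tail(1) by (subst Bochner_Integration.integral_add) auto
  also have "\<dots> \<le> P * (C2 * \<tau> powr (1 - \<sigma>)) + R * (C1 * \<tau> powr (- \<sigma>))"
    using core(2) tail(2) R assms(4) by (intro add_mono mult_left_mono) auto
  finally show ?thesis .
qed

text \<open>The local test function is extended globally and \<delta> tends to 0. The part of the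
  operator acting on the test function is of order \<open>\<delta> powr (1 - \<sigma>)\<close> and
  disappears since \<sigma> < 1.\<close>

lemma gradient_bound:
  assumes y0: "y0 \<in> \<Omega>" and V: "open V" "0 < r" "cball y0 r \<subseteq> V" "cball y0 r \<subseteq> \<Omega>"
    and grad: "C1_gradient_on \<phi>0 G0 V"
    and max: "\<And>y. y \<in> cball y0 r \<Longrightarrow> u y - \<phi>0 y \<le> u y0 - \<phi>0 y0"
    and \<tau>: "0 < \<tau>" "\<tau> < 1" "0 \<le> P"
    and le: "\<And>z. norm z < \<tau> \<Longrightarrow> y0 + z \<in> \<Omega> \<Longrightarrow> u (y0 + z) - u y0 \<le> P * norm z"
  shows "b0 * norm (G0 y0) powr m
    \<le> A0 + P * (C2 * \<tau> powr (1 - \<sigma>)) + R * (C1 * \<tau> powr (- \<sigma>))" (is "?l \<le> A0 + ?P + ?R")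
proof -
  have "bdd_above (u ` closure \<Omega>)" using bounded_u by (rule bounded_imp_bdd_above)
  moreover have "cball y0 r \<subseteq> closure \<Omega>" using V(4) closure_subset by blast
  ultimately obtain \<phi> D\<phi> where \<phi>: "C1_gradient_on \<phi> D\<phi> UNIV" "D\<phi> y0 = G0 y0"
    "\<And>y. y \<in> closure \<Omega> \<Longrightarrow> u y - \<phi> y \<le> u y0 - \<phi> y0"
    using extend_test_function[OF _ V(1-3) _ grad max, of "closure \<Omega>"] by auto
  have visc: "- nl_op \<Omega> \<nu> (ball 0 \<delta>) \<phi> y0 - nl_op \<Omega> \<nu> (- ball 0 \<delta>) u y0 + ?l \<le> A0" if "\<delta> > 0" for \<delta>
    using subsolution[unfolded viscosity_subsolution_def, THEN conjunct2, rule_format,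
        of \<phi> D\<phi> y0 \<delta>] C1_gradient_on_subset[OF \<phi>(1) subset_UNIV] y0 \<phi>(2,3) that
    by simp
  let ?C = "norm (G0 y0) + 1"
  have "(\<phi> has_derivative (\<lambda>h. G0 y0 \<bullet> h)) (at y0)"
    using \<phi>(1) unfolding C1_gradient_on_def \<phi>(2)[symmetric] by simp
  \<comment> \<open>Differentiability with error constant 1 gives linear growth at rate
    \<open>norm (G0 y0) + 1\<close> near \<open>y0\<close>.\<close>
  then obtain d where d: "d > 0"
    "\<And>y. norm (y - y0) < d \<Longrightarrow> norm (\<phi> y - \<phi> y0 - G0 y0 \<bullet> (y - y0)) \<le> 1 * norm (y - y0)"
    unfolding has_derivative_within_alt by (metis UNIV_I zero_less_one)
  have inc: "\<phi> (y0 + z) - \<phi> y0 \<le> ?C * norm z" if "norm z < d" for z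
  proof -
    have "\<bar>\<phi> (y0 + z) - \<phi> y0 - G0 y0 \<bullet> z\<bar> \<le> norm z" using d(2)[of "y0 + z"] that by simp
    then show ?thesis
      using Cauchy_Schwarz_ineq2[of "G0 y0" z] unfolding distrib_right by linarith
  qed
  have "?l - A0 - ?P - ?R \<le> ?C * (C2 * \<delta> powr (1 - \<sigma>))" if "0 < \<delta>" "\<delta> < min d 1" for \<delta>
  proof -
    have "nl_op \<Omega> \<nu> (ball 0 \<delta>) \<phi> y0 \<le> ?C * (C2 * \<delta> powr (1 - \<sigma>))"
      by (rule nl_op_ball_le[OF y0 that(1)]) (use that inc in auto)
    then show ?thesis
      using visc[OF that(1)] nl_op_tail_le[OF y0 \<tau> le, where \<delta> = \<delta>] by linarith
  qed
  then have ev: "eventually (\<lambda>\<delta>. ?l - A0 - ?P - ?R \<le> ?C * (C2 * \<delta> powr (1 - \<sigma>))) (at_right 0)"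
    using d(1) eventually_at_right[of 0 1 "\<lambda>\<delta>. ?l - A0 - ?P - ?R \<le> ?C * (C2 * \<delta> powr (1 - \<sigma>))"]
    by (auto intro!: exI[of _ "min d 1"])
  have "((\<lambda>\<delta>. \<delta> powr (1 - \<sigma>)) \<longlongrightarrow> 0) (at_right 0)"
  proof (rule tendsto_eq_rhs)
    show "((\<lambda>\<delta>. \<delta> powr (1 - \<sigma>)) \<longlongrightarrow> 0 powr (1 - \<sigma>)) (at_right 0)"
      using \<sigma>(2) eventually_at_right_less[of "0::real"]
      by (intro tendsto_powr2) (auto elim: eventually_mono)
  qed simp
  then have "((\<lambda>\<delta>. ?C * (C2 * \<delta> powr (1 - \<sigma>))) \<longlongrightarrow> 0) (at_right 0)"
    by (intro tendsto_mult_right_zero)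
  then have "?l - A0 - ?P - ?R \<le> 0"
    using ev by (rule tendsto_lowerbound) simp
  then show ?thesis by linarith
qed

end

section \<open>The barrier argument\<close>

lemma powr_diff_le:
  fixes a b :: real
  assumes "0 < a" "0 < b" "0 < \<gamma>" "\<gamma> \<le> 1"
  shows "b powr \<gamma> - a powr \<gamma> \<le> b powr (\<gamma> - 1) * \<bar>a - b\<bar>"
proof (cases "a \<le> b")
  case True
  \<comment> \<open>Raising a number in (0,1] to an exponent at most 1 increases it. The resulting
    slope is 1/\<gamma> times the derivative at \<open>b\<close> and works for \<open>a\<close>
    arbitrarily close to 0.\<close>
  have "a / b \<le> (a / b) powr \<gamma>"
    using powr_mono'[of \<gamma> 1 "a / b"] assms True by simp
  then have "b powr \<gamma> * (a / b) \<le> b powr \<gamma> * (a / b) powr \<gamma>"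
    by (intro mult_left_mono) auto
  also have "\<dots> = a powr \<gamma>" using assms by (simp add: powr_divide)
  finally show ?thesis
    using assms True by (simp add: powr_diff field_simps)
next
  case False
  then have "b powr \<gamma> \<le> a powr \<gamma>" using assms by (intro powr_mono2) auto
  then show ?thesis by (smt (verit) mult_nonneg_nonneg powr_ge_zero)
qed

text \<open>After division by \<open>Q powr m\<close> all exponents on the left are
  negative.\<close>

lemma powr_sum_less:
  fixes A B C c m \<sigma> \<kappa> :: real
  assumes "0 < m" "\<sigma> < m" "\<kappa> < m" "0 < c"
  shows "\<exists>Q0\<ge>1. \<forall>Q\<ge>Q0. A + B * Q powr \<sigma> + C * Q powr \<kappa> < c * Q powr m"
proof -
  have "((\<lambda>Q. A * Q powr (- m) + B * Q powr (\<sigma> - m) + C * Q powr (\<kappa> - m)) \<longlongrightarrow>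
      A * 0 + B * 0 + C * 0) at_top"
    using assms by (intro tendsto_intros tendsto_neg_powr filterlim_ident) auto
  then have "eventually (\<lambda>Q. A * Q powr (- m) + B * Q powr (\<sigma> - m) + C * Q powr (\<kappa> - m) < c) at_top"
    using assms(4) by (intro order_tendstoD(2)) auto
  then obtain Q0 where Q0:
    "\<And>Q. Q \<ge> Q0 \<Longrightarrow> A * Q powr (- m) + B * Q powr (\<sigma> - m) + C * Q powr (\<kappa> - m) < c"
    unfolding eventually_at_top_linorder by blast
  have "A + B * Q powr \<sigma> + C * Q powr \<kappa> < c * Q powr m" if "Q \<ge> max 1 Q0" for Q
  proof -
    have "(A * Q powr (- m) + B * Q powr (\<sigma> - m) + C * Q powr (\<kappa> - m)) * Q powr m < c * Q powr m"
      using Q0[of Q] that by (intro mult_strict_right_mono) auto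
    then show ?thesis
      using that by (simp add: distrib_right mult.assoc flip: powr_add)
  qed
  then show ?thesis by (intro exI[of _ "max 1 Q0"]) auto
qed

text \<open>Excludes cancellation between the cone and the barrier. In the first case, four times
  the squared norm exceeds \<open>(L + \<mu>)\<^sup>2\<close> by at least
  \<open>3 * (L - \<mu>)\<^sup>2 + 2 * L * \<mu>\<close>; in the second, the barrier term is too
  small to matter.\<close>

lemma norm_diff_ge_half_sum:
  fixes e g :: "'a::real_inner"
  assumes "norm e = 1" "1 \<le> norm g" "0 \<le> L" "0 \<le> \<mu>"
    and "g \<bullet> e \<le> 1/4 \<or> \<mu> * norm g \<le> L / 4"
  shows "(L + \<mu>) / 2 \<le> norm (L *\<^sub>R e - \<mu> *\<^sub>R g)"
  using assms(5)
proof
  assume ge: "g \<bullet> e \<le> 1/4"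
  have "(norm (L *\<^sub>R e - \<mu> *\<^sub>R g))\<^sup>2 = L\<^sup>2 * (e \<bullet> e) - 2 * (L * \<mu>) * (g \<bullet> e) + \<mu>\<^sup>2 * (g \<bullet> g)"
    unfolding power2_norm_eq_inner
    by (simp add: inner_diff_left inner_diff_right power2_eq_square inner_commute)
  moreover have "e \<bullet> e = 1" using assms(1) by (simp add: dot_square_norm)
  moreover have "\<mu>\<^sup>2 * 1 \<le> \<mu>\<^sup>2 * (g \<bullet> g)"
    using assms(2) by (intro mult_left_mono) (simp_all add: dot_square_norm)
  moreover have "2 * (L * \<mu>) * (g \<bullet> e) \<le> 2 * (L * \<mu>) * (1/4)"
    using ge assms by (intro mult_left_mono) auto
  moreover have "0 \<le> (L - \<mu>)\<^sup>2" "0 \<le> L * \<mu>" using assms by auto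
  ultimately have "((L + \<mu>) / 2)\<^sup>2 \<le> (norm (L *\<^sub>R e - \<mu> *\<^sub>R g))\<^sup>2"
    by (simp add: power2_eq_square field_simps)
  then show ?thesis by (rule power2_le_imp_le) simp
next
  assume le: "\<mu> * norm g \<le> L / 4"
  have "\<mu> * 1 \<le> \<mu> * norm g" using assms by (intro mult_left_mono) auto
  then have "\<mu> \<le> L / 4" using le by simp
  moreover have "L - L / 4 \<le> norm (L *\<^sub>R e - \<mu> *\<^sub>R g)"
    using norm_triangle_ineq2[of "L *\<^sub>R e" "\<mu> *\<^sub>R g"] assms le by simp
  ultimately show ?thesis using assms(3) by (simp add: field_simps)
qed

text \<open>The last bound on \<open>L\<close> forces contact points to within \<open>r/4\<close> of
  \<open>x0\<close>, and \<open>4 / r \<le> L\<close> keeps jumps of length at most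
  \<open>1 / (4 * L)\<close> from leaving the ball of radius \<open>r/2\<close>.\<close>

locale barrier_setting = nonlocal_subsolution \<Omega> \<nu> \<sigma> C1 C2 m b0 A0 u
  for \<Omega> :: "'a::euclidean_space set" and \<nu> \<sigma> C1 C2 m b0 A0 u +
  fixes p x0 :: 'a and r L :: real and \<rho> :: "'a \<Rightarrow> real" and G :: "'a \<Rightarrow> 'a"
  assumes chart: "level_chart \<Omega> p r \<rho> G"
    and x0: "x0 \<in> \<Omega>" "x0 \<in> ball p (r/2)"
    and L_ge: "1 \<le> L" "4 / r \<le> L" "R + 2 < L * (r / 4)"
begin

abbreviation M :: real where "M \<equiv> norm (G p) + 1"

text \<open>Half of the critical exponent \<open>1 - \<sigma> / m\<close>, below which
  \<open>\<sigma> / (1 - \<gamma>) < m\<close>.\<close>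

definition \<gamma> :: real where "\<gamma> = (1 - \<sigma> / m) / 2"

lemma \<gamma>: "0 < \<gamma>" "\<gamma> \<le> 1/2" "\<sigma> / (1 - \<gamma>) < m"
proof -
  have m0: "0 < m" using m \<sigma> by simp
  then have sm: "0 < \<sigma> / m" "\<sigma> / m < 1" using m \<sigma> by auto
  then show "0 < \<gamma>" by (simp add: \<gamma>_def)
  show "\<gamma> \<le> 1/2" using m0 \<sigma> by (simp add: \<gamma>_def)
  have "\<sigma> / (1 - \<gamma>) = 2 * \<sigma> * m / (m + \<sigma>)"
    using m0 \<sigma> by (simp add: \<gamma>_def field_simps)
  also have "\<dots> < m" using m0 m \<sigma> by (simp add: field_simps)
  finally show "\<sigma> / (1 - \<gamma>) < m" .
qed

lemma r_pos: "0 < r" using chart unfolding level_chart_def by simp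

lemma M_ge: "2 \<le> M" using chart unfolding level_chart_def by simp

lemma near_in_ball: "y \<in> ball x0 (r/2) \<Longrightarrow> y \<in> ball p r"
  using x0(2) dist_triangle[of p y x0] by simp

lemma near_iff: "y \<in> ball x0 (r/2) \<Longrightarrow> y \<in> \<Omega> \<longleftrightarrow> 0 < \<rho> y"
  using near_in_ball[of y] chart unfolding level_chart_def by simp

lemma x0_near: "x0 \<in> ball x0 (r/2)" using r_pos by simp

lemma \<rho>_x0: "0 < \<rho> x0" using near_iff[OF x0_near] x0(1) by simp

text \<open>At the maximum the test gradient is \<open>L *\<^sub>R e - \<mu> *\<^sub>R G\<close>.
  The alternative in the hypotheses excludes cancellation, so its norm is at least
  \<open>Q / 2\<close>. The constant \<open>B\<close> compares finite increments of \<open>g\<close>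
  with its slope, which bounds the growth of \<open>u\<close> by a multiple of the same
  \<open>Q\<close>.\<close>

lemma contact_estimate:
  assumes y0: "y0 \<in> \<Omega>" "norm (y0 - x0) < r/4" "y0 \<noteq> x0"
    and g: "\<And>t. 0 < t \<Longrightarrow> (g has_real_derivative - \<mu> t) (at t)" "continuous_on {0<..} \<mu>"
    and \<mu>: "0 \<le> \<mu> (\<rho> y0)" "\<rho> y0 \<le> \<rho> x0 \<or> \<mu> (\<rho> y0) * M \<le> L / 4"
    and B: "1 \<le> B" "\<And>a. 0 < a \<Longrightarrow> \<bar>a - \<rho> y0\<bar> \<le> M * \<tau> \<Longrightarrow>
      g a - g (\<rho> y0) \<le> B * \<mu> (\<rho> y0) * \<bar>a - \<rho> y0\<bar>"
    and max: "\<And>y. y \<in> \<Omega> \<Longrightarrow> y \<in> ball x0 (r/2) \<Longrightarrow>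
      u y - L * norm (y - x0) - g (\<rho> y) \<le> u y0 - L * norm (y0 - x0) - g (\<rho> y0)"
    and \<tau>: "0 < \<tau>" "\<tau> < 1" "\<tau> \<le> r / 4"
  defines "Q \<equiv> L + \<mu> (\<rho> y0)"
  shows "b0 * (Q / 2) powr m \<le> A0 + (M * B * Q) * (C2 * \<tau> powr (1 - \<sigma>)) + R * (C1 * \<tau> powr (- \<sigma>))"
proof -
  have y0b: "y0 \<in> ball x0 (r/2)" using y0(2) r_pos by (simp add: dist_norm norm_minus_commute)
  have \<rho>0: "0 < \<rho> y0" using near_iff[OF y0b] y0(1) by simp
  \<comment> \<open>The point \<open>x0\<close> is removed because the norm is not differentiable
    there.\<close>
  define V where "V = {y. 0 < \<rho> y} - {x0}"
  define \<phi> where "\<phi> y = L * norm (y - x0) + g (\<rho> y)" for y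
  define D where "D y = L *\<^sub>R sgn (y - x0) - \<mu> (\<rho> y) *\<^sub>R G y" for y
  note \<rho>_cont = level_chart_continuous[OF chart]
  have V: "open V" unfolding V_def
    using \<rho>_cont(1) by (intro open_Diff open_Collect_less) auto
  have "open (V \<inter> (\<Omega> \<inter> ball x0 (r/2)))" using V open_domain by auto
  moreover have "y0 \<in> V \<inter> (\<Omega> \<inter> ball x0 (r/2))" using y0 y0b \<rho>0 by (simp add: V_def)
  ultimately obtain d where d: "0 < d" "cball y0 d \<subseteq> V \<inter> (\<Omega> \<inter> ball x0 (r/2))"
    using open_contains_cball by blast
  have "C1_gradient_on \<phi> D V"
    unfolding C1_gradient_on_def
  proof (intro conjI ballI)
    show "continuous_on V D"
      unfolding D_def
      by (intro continuous_intros \<rho>_cont continuous_on_compose2[OF g(2)]) (auto simp: V_def)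
    fix y assume y: "y \<in> V"
    have "((\<lambda>y. norm (y - x0)) has_derivative (\<lambda>h. sgn (y - x0) \<bullet> h)) (at y)"
    proof (rule has_derivative_compose[of "\<lambda>y. y - x0" "\<lambda>h. h" y UNIV norm])
      show "((\<lambda>y. y - x0) has_derivative (\<lambda>h. h)) (at y)"
        by (auto intro!: derivative_eq_intros)
      show "(norm has_derivative (\<lambda>h. sgn (y - x0) \<bullet> h)) (at (y - x0))"
        using has_derivative_norm[of "y - x0"] y by (simp add: V_def inner_commute)
    qed
    moreover have "((\<lambda>y. g (\<rho> y)) has_derivative (\<lambda>h. - \<mu> (\<rho> y) * (G y \<bullet> h))) (at y)"
      using y has_derivative_compose[OF level_chart_derivative[OF chart]
          g(1)[unfolded has_field_derivative_def]]
      by (auto simp: V_def)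
    ultimately have "(\<phi> has_derivative (\<lambda>h. L * (sgn (y - x0) \<bullet> h) + - \<mu> (\<rho> y) * (G y \<bullet> h))) (at y)"
      unfolding \<phi>_def by (intro has_derivative_add has_derivative_mult_right)
    moreover have "(\<lambda>h. L * (sgn (y - x0) \<bullet> h) + - \<mu> (\<rho> y) * (G y \<bullet> h)) = (\<lambda>h. D y \<bullet> h)"
      by (simp add: D_def inner_diff_left fun_eq_iff)
    ultimately show "(\<phi> has_derivative (\<lambda>h. D y \<bullet> h)) (at y within V)"
      using has_derivative_at_withinI by metis
  qed
  moreover have "u y - \<phi> y \<le> u y0 - \<phi> y0" if "y \<in> cball y0 d" for y
    using max[of y] subsetD[OF d(2) that] by (simp add: \<phi>_def)
  moreover have "0 \<le> M * B * Q" using M_ge B(1) L_ge(1) \<mu>(1) by (simp add: Q_def)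
  \<comment> \<open>Maximality transfers the growth of the penalty to \<open>u\<close>;
    \<open>norm z < \<tau>\<close> keeps \<open>y0 + z\<close> in the ball where maximality
    holds.\<close>
  moreover have "u (y0 + z) - u y0 \<le> M * B * Q * norm z" if z: "norm z < \<tau>" "y0 + z \<in> \<Omega>" for z
  proof -
    have "norm (y0 + z - x0) \<le> norm (y0 - x0) + norm z"
      using norm_triangle_ineq[of "y0 - x0" z] by (simp add: algebra_simps)
    then have b: "y0 + z \<in> ball x0 (r/2)"
      using y0(2) z(1) \<tau>(3) by (simp add: dist_norm norm_minus_commute)
    have "L * norm (y0 + z - x0) \<le> L * (norm (y0 - x0) + norm z)"
      using \<open>norm (y0 + z - x0) \<le> norm (y0 - x0) + norm z\<close> L_ge(1) by (intro mult_left_mono) auto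
    moreover have lip: "\<bar>\<rho> (y0 + z) - \<rho> y0\<bar> \<le> M * norm z"
      using level_chart_lipschitz[OF chart near_in_ball[OF y0b] near_in_ball[OF b]] by simp
    moreover have "M * norm z \<le> M * \<tau>" using z(1) M_ge by (intro mult_left_mono) auto
    then have "g (\<rho> (y0 + z)) - g (\<rho> y0) \<le> B * \<mu> (\<rho> y0) * \<bar>\<rho> (y0 + z) - \<rho> y0\<bar>"
      using near_iff[OF b] z(2) lip by (intro B(2)) auto
    moreover have "B * \<mu> (\<rho> y0) * \<bar>\<rho> (y0 + z) - \<rho> y0\<bar> \<le> B * \<mu> (\<rho> y0) * (M * norm z)"
      using lip B(1) \<mu>(1) by (intro mult_left_mono) auto
    moreover have "u (y0 + z) - L * norm (y0 + z - x0) - g (\<rho> (y0 + z))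
        \<le> u y0 - L * norm (y0 - x0) - g (\<rho> y0)"
      using z(2) b by (rule max)
    moreover have "L * norm z \<le> M * B * L * norm z"
    proof -
      have "1 * 1 \<le> M * B" using M_ge B(1) by (intro mult_mono) auto
      then have "1 * (L * norm z) \<le> M * B * (L * norm z)" using L_ge(1) by (intro mult_right_mono) auto
      then show ?thesis by (simp add: mult.assoc)
    qed
    ultimately show ?thesis unfolding Q_def by (simp add: algebra_simps)
  qed
  ultimately have *: "b0 * norm (D y0) powr m
      \<le> A0 + M * B * Q * (C2 * \<tau> powr (1 - \<sigma>)) + R * (C1 * \<tau> powr (- \<sigma>))"
    using d \<tau>(1,2) by (intro gradient_bound[OF y0(1) V d(1)]) auto
  have "Q / 2 \<le> norm (D y0)"
    unfolding Q_def D_def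
  proof (rule norm_diff_ge_half_sum)
    show "norm (sgn (y0 - x0)) = 1" using y0(3) by (simp add: norm_sgn)
    show "1 \<le> norm (G y0)" using chart unfolding level_chart_def by blast
    show "0 \<le> L" using L_ge(1) by simp
    show "G y0 \<bullet> sgn (y0 - x0) \<le> 1/4 \<or> \<mu> (\<rho> y0) * norm (G y0) \<le> L / 4"
      using \<mu>(2)
    proof
      assume "\<rho> y0 \<le> \<rho> x0"
      then have "G y0 \<bullet> (y0 - x0) \<le> norm (y0 - x0) / 4"
        using level_chart_gradient_inner[OF chart near_in_ball[OF x0_near] near_in_ball[OF y0b]] by simp
      moreover have "G y0 \<bullet> sgn (y0 - x0) = (G y0 \<bullet> (y0 - x0)) / norm (y0 - x0)"
        by (simp add: sgn_div_norm divide_inverse mult.commute)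
      ultimately have "G y0 \<bullet> sgn (y0 - x0) \<le> 1/4" using y0(3) by (simp add: pos_divide_le_eq)
      then show ?thesis ..
    next
      assume "\<mu> (\<rho> y0) * M \<le> L / 4"
      moreover have "\<mu> (\<rho> y0) * norm (G y0) \<le> \<mu> (\<rho> y0) * M"
        using level_chart_norm_gradient[OF chart near_in_ball[OF y0b]] \<mu>(1) by (intro mult_left_mono)
      ultimately show ?thesis by simp
    qed
  qed (rule \<mu>(1))
  moreover have "0 \<le> Q / 2" "0 \<le> m" using L_ge(1) \<mu>(1) m \<sigma>(1) by (simp_all add: Q_def)
  ultimately have "b0 * (Q / 2) powr m \<le> b0 * norm (D y0) powr m"
    using b0 by (intro mult_left_mono powr_mono2) auto
  with * show ?thesis by linarith
qed

end

section \<open>The singular penalty and its maximum points\<close>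

context barrier_setting
begin

definition K :: real where "K = M / \<gamma>"

text \<open>The first term blows up at the frontier and produces interior maxima. The second stays
  bounded, but its slope blows up, which makes the gradient term dominate near the frontier.\<close>

definition pen :: "real \<Rightarrow> real \<Rightarrow> real \<Rightarrow> real" where
  "pen \<epsilon> k t = \<epsilon> / t - k * t powr \<gamma>"

definition dpen :: "real \<Rightarrow> real \<Rightarrow> real \<Rightarrow> real" where
  "dpen \<epsilon> k t = \<epsilon> / t\<^sup>2 + k * \<gamma> * t powr (\<gamma> - 1)"

definition F :: "real \<Rightarrow> real \<Rightarrow> 'a \<Rightarrow> real" where
  "F \<epsilon> k y = u y - L * norm (y - x0) - pen \<epsilon> k (\<rho> y)"

definition critical :: "real \<Rightarrow> real \<Rightarrow> 'a \<Rightarrow> bool" where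
  "critical \<epsilon> k y0 \<longleftrightarrow> y0 \<in> \<Omega> \<and> y0 \<in> ball x0 (r/2) \<and>
     (\<forall>y\<in>\<Omega> \<inter> ball x0 (r/2). F \<epsilon> k y \<le> F \<epsilon> k y0)"

lemma K_ge: "4 \<le> K"
proof -
  have "4 * \<gamma> \<le> M" using \<gamma> M_ge by linarith
  then show ?thesis using \<gamma>(1) by (simp add: K_def pos_le_divide_eq)
qed

lemma pen_deriv: "0 < t \<Longrightarrow> (pen \<epsilon> k has_real_derivative - dpen \<epsilon> k t) (at t)"
  unfolding pen_def dpen_def
  by (auto intro!: derivative_eq_intros simp: power2_eq_square)

lemma pen_cont: "continuous_on {0<..} (pen \<epsilon> k)"
  using pen_deriv by (intro continuous_at_imp_continuous_on ballI DERIV_isCont) auto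

lemma dpen_cont: "continuous_on {0<..} (dpen \<epsilon> k)"
  unfolding dpen_def by (intro continuous_intros) auto

lemma dpen_nonneg: "0 \<le> \<epsilon> \<Longrightarrow> 0 \<le> k \<Longrightarrow> 0 \<le> dpen \<epsilon> k t"
  using \<gamma>(1) by (simp add: dpen_def)

text \<open>For the singular term, \<open>a\<close> at least \<open>b / 2\<close> costs a factor 2,
  which is at most 1/\<gamma>; the power term has the factor 1/\<gamma> by
  \<open>powr_diff_le\<close>, without restriction on \<open>a\<close>.\<close>

lemma pen_diff_le:
  assumes "0 < a" "0 < b" "0 \<le> \<epsilon>" "0 \<le> k" "\<epsilon> = 0 \<or> b / 2 \<le> a"
  shows "pen \<epsilon> k a - pen \<epsilon> k b \<le> 1 / \<gamma> * dpen \<epsilon> k b * \<bar>a - b\<bar>"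
proof -
  have "\<epsilon> / a - \<epsilon> / b \<le> 1 / \<gamma> * (\<epsilon> / b\<^sup>2) * \<bar>a - b\<bar>"
  proof (cases "\<epsilon> = 0")
    case False
    then have ab: "b / 2 \<le> a" using assms(5) by simp
    have "\<epsilon> / a - \<epsilon> / b = \<epsilon> * (b - a) / (a * b)" using assms by (simp add: field_simps)
    also have "\<dots> \<le> \<epsilon> * \<bar>a - b\<bar> / (a * b)"
      using assms by (intro divide_right_mono mult_left_mono) auto
    also have "\<dots> \<le> \<epsilon> * \<bar>a - b\<bar> / ((b / 2) * b)"
      using assms ab by (intro divide_left_mono mult_right_mono mult_pos_pos) auto
    also have "\<dots> = 2 * (\<epsilon> / b\<^sup>2 * \<bar>a - b\<bar>)" by (simp add: power2_eq_square)
    also have "\<dots> \<le> 1 / \<gamma> * (\<epsilon> / b\<^sup>2 * \<bar>a - b\<bar>)"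
      using \<gamma> assms by (intro mult_right_mono) (auto simp: field_simps)
    finally show ?thesis by (simp add: mult.assoc)
  qed simp
  moreover have "k * (b powr \<gamma> - a powr \<gamma>) \<le> k * (b powr (\<gamma> - 1) * \<bar>a - b\<bar>)"
    using powr_diff_le[of a b \<gamma>] assms \<gamma> by (intro mult_left_mono) auto
  moreover have "1 / \<gamma> * dpen \<epsilon> k b * \<bar>a - b\<bar>
      = 1 / \<gamma> * (\<epsilon> / b\<^sup>2) * \<bar>a - b\<bar> + k * (b powr (\<gamma> - 1) * \<bar>a - b\<bar>)"
    using \<gamma>(1) by (simp add: dpen_def field_simps)
  ultimately show ?thesis unfolding pen_def by (simp add: algebra_simps)
qed

lemma scale_powr:
  assumes "0 < X" "0 < \<tau>" "\<tau> \<le> 1 / X"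
  shows "X * \<tau> powr (1 - \<sigma>) \<le> X powr \<sigma>"
proof -
  have "\<tau> powr (1 - \<sigma>) \<le> (1 / X) powr (1 - \<sigma>)" using assms \<sigma> by (intro powr_mono2) auto
  then have "X * \<tau> powr (1 - \<sigma>) \<le> X * (1 / X) powr (1 - \<sigma>)" using assms by simp
  also have "\<dots> = X powr 1 * X powr (\<sigma> - 1)"
    using assms by (simp add: powr_divide powr_minus_divide[symmetric])
  also have "\<dots> = X powr \<sigma>" by (subst powr_add[symmetric]) simp
  finally show ?thesis .
qed

text \<open>This is \<open>contact_estimate\<close> with \<open>B = 1 / \<gamma>\<close>. Jumps
  below the scale \<open>1 / (K * Q)\<close> contribute only the power \<sigma> of that
  rate.\<close>

lemma critical_estimate:
  assumes crit: "critical \<epsilon> k y0" "y0 \<noteq> x0" "norm (y0 - x0) < r / 4"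
    and nonneg: "0 \<le> \<epsilon>" "0 \<le> k"
    and side: "\<rho> y0 \<le> \<rho> x0 \<or> dpen \<epsilon> k (\<rho> y0) * M \<le> L / 4"
    and \<tau>: "0 < \<tau>" "\<tau> \<le> 1 / (K * (L + dpen \<epsilon> k (\<rho> y0)))" "\<epsilon> = 0 \<or> M * \<tau> \<le> \<rho> y0 / 2"
  shows "b0 * ((L + dpen \<epsilon> k (\<rho> y0)) / 2) powr m
    \<le> A0 + C2 * (K * (L + dpen \<epsilon> k (\<rho> y0))) powr \<sigma> + R * (C1 * \<tau> powr (- \<sigma>))"
proof -
  define Q where "Q = L + dpen \<epsilon> k (\<rho> y0)"
  have QL: "L \<le> Q" using dpen_nonneg[OF nonneg] by (simp add: Q_def)
  have y0: "y0 \<in> \<Omega>" "y0 \<in> ball x0 (r/2)" using crit(1) by (auto simp: critical_def)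
  then have \<rho>0: "0 < \<rho> y0" using near_iff by blast
  have KQ: "4 * L \<le> K * Q" using K_ge QL L_ge(1) by (intro mult_mono) auto
  then have KQ0: "0 < K * Q" "1 < K * Q" using L_ge(1) by linarith+
  have "1 / (K * Q) \<le> 1 / (4 * L)"
    using KQ L_ge(1) by (intro frac_le) auto
  then have "\<tau> \<le> 1 / (4 * L)" using \<tau>(2) by (simp add: Q_def)
  also have "\<dots> \<le> r / 4" using L_ge(1,2) r_pos by (simp add: field_simps)
  finally have \<tau>r: "\<tau> \<le> r / 4" .
  have "1 / (K * Q) < 1" using KQ0 by simp
  then have \<tau>1: "\<tau> < 1" using \<tau>(2) by (simp add: Q_def)
  have "b0 * (Q / 2) powr m
      \<le> A0 + M * (1 / \<gamma>) * Q * (C2 * \<tau> powr (1 - \<sigma>)) + R * (C1 * \<tau> powr (- \<sigma>))"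
    unfolding Q_def
  proof (rule contact_estimate[where g = "pen \<epsilon> k"])
    show "1 \<le> 1 / \<gamma>" using \<gamma>(1,2) by simp
    show "pen \<epsilon> k a - pen \<epsilon> k (\<rho> y0) \<le> 1 / \<gamma> * dpen \<epsilon> k (\<rho> y0) * \<bar>a - \<rho> y0\<bar>"
      if "0 < a" "\<bar>a - \<rho> y0\<bar> \<le> M * \<tau>" for a
      using that \<tau>(3) by (intro pen_diff_le[OF _ \<rho>0 nonneg]) auto
    show "u y - L * norm (y - x0) - pen \<epsilon> k (\<rho> y) \<le> u y0 - L * norm (y0 - x0) - pen \<epsilon> k (\<rho> y0)"
      if "y \<in> \<Omega>" "y \<in> ball x0 (r/2)" for y
      using crit(1) that unfolding critical_def F_def by blast
  qed (use y0 crit side \<tau> \<tau>1 \<tau>r pen_deriv dpen_cont dpen_nonneg[OF nonneg] in auto)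
  also have "M * (1 / \<gamma>) * Q * (C2 * \<tau> powr (1 - \<sigma>)) = C2 * (K * Q * \<tau> powr (1 - \<sigma>))"
    by (simp add: K_def)
  also have "\<dots> \<le> C2 * (K * Q) powr \<sigma>"
    using C2_pos \<tau>(1,2) by (intro mult_left_mono scale_powr[OF KQ0(1)]) (auto simp: Q_def)
  finally show ?thesis by (simp add: Q_def)
qed

section \<open>Maximum points for a fixed \<open>k\<close>\<close>

context
  fixes k :: real
  assumes k: "0 < k" "k * (\<rho> x0 + M * r) powr \<gamma> \<le> 1"
begin

lemma k_\<rho>_le:
  assumes "y \<in> \<Omega>" "y \<in> ball x0 (r/2)"
  shows "k * \<rho> y powr \<gamma> \<le> 1"
proof -
  have "\<bar>\<rho> y - \<rho> x0\<bar> \<le> M * norm (y - x0)"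
    using level_chart_lipschitz[OF chart near_in_ball[OF x0_near] near_in_ball[OF assms(2)]] .
  also have "\<dots> \<le> M * r"
    using assms(2) r_pos M_ge by (intro mult_left_mono) (auto simp: dist_norm norm_minus_commute)
  finally have "\<rho> y \<le> \<rho> x0 + M * r" by linarith
  moreover have "0 < \<rho> y" using near_iff assms by blast
  ultimately have "\<rho> y powr \<gamma> \<le> (\<rho> x0 + M * r) powr \<gamma>" using \<gamma>(1) by (intro powr_mono2) auto
  then have "k * \<rho> y powr \<gamma> \<le> k * (\<rho> x0 + M * r) powr \<gamma>" using k(1) by simp
  then show ?thesis using k(2) by linarith
qed

lemma F_x0_ge:
  assumes "\<epsilon> \<le> \<rho> x0"
  shows "u x0 - 1 \<le> F \<epsilon> k x0"
proof -
  have "\<epsilon> / \<rho> x0 \<le> 1" using assms \<rho>_x0 by simp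
  moreover have "0 \<le> k * \<rho> x0 powr \<gamma>" using k(1) by simp
  ultimately show ?thesis by (simp add: F_def pen_def)
qed

text \<open>A point beating \<open>x0\<close> gains at most \<open>R\<close> from \<open>u\<close>,
  while the penalty contributes at most 1 at each of the two points. Hence
  \<open>L * norm (y - x0) + \<epsilon> / \<rho> y \<le> R + 2\<close>.\<close>

lemma large_F:
  assumes y: "y \<in> \<Omega>" "y \<in> ball x0 (r/2)" and \<epsilon>: "0 \<le> \<epsilon>" "\<epsilon> \<le> \<rho> x0"
    and "F \<epsilon> k x0 \<le> F \<epsilon> k y"
  shows "norm (y - x0) < r / 4" "\<epsilon> / (R + 2) \<le> \<rho> y"
proof -
  have \<rho>y: "0 < \<rho> y" using near_iff y by blast
  have R0: "0 \<le> R" using R_nonneg x0(1) .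
  have uR: "u y - u x0 \<le> R" using diff_le_R in_closure y(1) x0(1) by blast
  have 1: "L * norm (y - x0) + \<epsilon> / \<rho> y \<le> R + 2"
    using assms(5) F_x0_ge[OF \<epsilon>(2)] k_\<rho>_le[OF y] uR by (simp add: F_def[of _ _ y] pen_def)
  then have "L * norm (y - x0) \<le> R + 2"
    using \<epsilon>(1) \<rho>y by (smt (verit) divide_nonneg_pos)
  then have "L * norm (y - x0) < L * (r / 4)" using L_ge(3) by linarith
  then show "norm (y - x0) < r / 4" using L_ge(1) by simp
  have "0 \<le> L * norm (y - x0)" using L_ge(1) by simp
  then have "\<epsilon> / \<rho> y \<le> R + 2" using 1 by linarith
  then show "\<epsilon> / (R + 2) \<le> \<rho> y" using \<rho>y R0 by (simp add: field_simps)
qed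

text \<open>Restriction to levels at least \<open>t\<close> leaves a compact subset of \<Omega> on
  which the penalty is continuous, even for \<epsilon> = 0.\<close>

lemma F_attains_max:
  assumes "0 < t" "t \<le> \<rho> x0"
  shows "\<exists>y0\<in>\<Omega> \<inter> cball x0 (r/4). t \<le> \<rho> y0 \<and> (\<forall>y\<in>cball x0 (r/4). t \<le> \<rho> y \<longrightarrow> F \<epsilon> k y \<le> F \<epsilon> k y0)"
proof -
  define S where "S = cball x0 (r/4) \<inter> {y. t \<le> \<rho> y}"
  have "closed {y. t \<le> \<rho> y}"
    using level_chart_continuous(1)[OF chart] by (intro closed_Collect_le) auto
  then have "compact S" unfolding S_def by (intro compact_Int_closed) auto
  have S\<Omega>: "S \<subseteq> \<Omega>"
  proof
    fix y assume y: "y \<in> S"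
    then have "y \<in> ball x0 (r/2)" using r_pos by (simp add: S_def)
    then show "y \<in> \<Omega>" using near_iff[of y] y assms(1) by (simp add: S_def)
  qed
  have "usc_on (\<lambda>y. u y + (- L * norm (y - x0) - pen \<epsilon> k (\<rho> y))) S"
  proof (rule usc_on_add_continuous)
    show "usc_on u (closure \<Omega>)" using subsolution unfolding viscosity_subsolution_def by simp
    show "S \<subseteq> closure \<Omega>" using S\<Omega> closure_subset by blast
    show "continuous_on S (\<lambda>y. - L * norm (y - x0) - pen \<epsilon> k (\<rho> y))"
      using assms(1)
      by (intro continuous_intros level_chart_continuous[OF chart] continuous_on_compose2[OF pen_cont])
        (auto simp: S_def)
  qed
  then have "usc_on (F \<epsilon> k) S" by (simp add: F_def[abs_def] algebra_simps)
  moreover have "x0 \<in> S" using assms r_pos by (simp add: S_def)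
  ultimately obtain y0 where "y0 \<in> S" "\<forall>y\<in>S. F \<epsilon> k y \<le> F \<epsilon> k y0"
    using usc_on_attains_max[OF \<open>compact S\<close>] by blast
  then show ?thesis using S\<Omega> by (intro bexI[of _ y0]) (auto simp: S_def)
qed

text \<open>By \<open>large_F\<close>, points of the half ball outside the compact set with level
  \<open>\<epsilon> / (R + 2)\<close> lose to \<open>x0\<close>, so the maximum over that set is a
  maximum over the half ball.\<close>

lemma critical_exists:
  assumes "0 < \<epsilon>" "\<epsilon> \<le> \<rho> x0"
  shows "\<exists>y0. critical \<epsilon> k y0 \<and> norm (y0 - x0) < r / 4"
proof -
  have R0: "0 \<le> R" using R_nonneg x0(1) .
  let ?t = "\<epsilon> / (R + 2)"
  have "?t \<le> \<epsilon> / 1" using R0 assms(1) by (intro divide_left_mono) auto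
  then have t: "0 < ?t" "?t \<le> \<rho> x0" using assms R0 by auto
  obtain y0 where y0: "y0 \<in> \<Omega>" "y0 \<in> cball x0 (r/4)" "?t \<le> \<rho> y0"
    "\<And>y. y \<in> cball x0 (r/4) \<Longrightarrow> ?t \<le> \<rho> y \<Longrightarrow> F \<epsilon> k y \<le> F \<epsilon> k y0"
    using F_attains_max[OF t] by blast
  have x0y0: "F \<epsilon> k x0 \<le> F \<epsilon> k y0" using t(2) r_pos by (intro y0(4)) auto
  have y0b: "y0 \<in> ball x0 (r/2)" using y0(2) r_pos by simp
  have "F \<epsilon> k y \<le> F \<epsilon> k y0" if y: "y \<in> \<Omega>" "y \<in> ball x0 (r/2)" for y
  proof (cases "F \<epsilon> k x0 \<le> F \<epsilon> k y")
    case True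
    then show ?thesis
      using large_F[OF y _ assms(2) True] assms(1)
      by (intro y0(4)) (auto simp: dist_norm norm_minus_commute)
  qed (use x0y0 in linarith)
  then have "critical \<epsilon> k y0" unfolding critical_def using y0(1) y0b by blast
  moreover have "norm (y0 - x0) < r / 4"
    using large_F(1)[OF y0(1) y0b _ assms(2) x0y0] assms(1) by simp
  ultimately show ?thesis by blast
qed


text \<open>
  With \<open>Q = L + dpen \<epsilon> k (\<rho> y0)\<close> the left-hand side below grows like \<open>Q powr m\<close>. The barrier
  \<open>- k * t powr \<gamma>\<close> alone makes \<open>Q\<close> at least of order \<open>\<rho> y0 powr (\<gamma> - 1)\<close>, and
  \<open>\<sigma> / (1 - \<gamma>) < m\<close> lets this absorb the cost \<open>\<rho> y0 powr - \<sigma>\<close> of the long jumps,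
  uniformly in \<open>\<epsilon>\<close>.
\<close>

lemma critical_level_lower_bound:
  "\<exists>t>0. t \<le> \<rho> x0 \<and> (\<forall>\<epsilon> y0. 0 < \<epsilon> \<longrightarrow> critical \<epsilon> k y0 \<longrightarrow> norm (y0 - x0) < r / 4 \<longrightarrow> t \<le> \<rho> y0)"
proof -
  have R0: "0 \<le> R" using R_nonneg x0(1) .
  define \<kappa> where "\<kappa> = \<sigma> / (1 - \<gamma>)"
  have \<kappa>: "\<kappa> < m" "0 < \<kappa>" "(\<gamma> - 1) * \<kappa> = - \<sigma>"
    using \<gamma> \<sigma> by (auto simp: \<kappa>_def field_simps)
  have k\<gamma>: "0 < k * \<gamma>" using k(1) \<gamma>(1) by simp
  define B where "B = (C2 + R * C1) * K powr \<sigma>"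
  define C where "C = R * C1 * ((2 * M) powr \<sigma> * (1 / (k * \<gamma>)) powr \<kappa>)"
  define c where "c = b0 * (1/2) powr m"
  have "0 < m" "0 < c" using m \<sigma> b0 by (auto simp: c_def)
  then obtain Q1 where Q1: "1 \<le> Q1"
    "\<And>Q. Q1 \<le> Q \<Longrightarrow> A0 + B * Q powr \<sigma> + C * Q powr \<kappa> < c * Q powr m"
    using powr_sum_less[OF _ m \<kappa>(1)] by blast
  \<comment> \<open>The second entry is the level at which the slope of the power term equals
    \<open>Q1\<close>; below it the slope exceeds \<open>Q1\<close>.\<close>
  define t where "t = min (\<rho> x0) ((Q1 / (k * \<gamma>)) powr (1 / (\<gamma> - 1)))"
  have t: "0 < t" "t \<le> \<rho> x0" using \<rho>_x0 Q1(1) k\<gamma> by (auto simp: t_def)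
  have "t \<le> \<rho> y0" if \<epsilon>: "0 < \<epsilon>" and crit: "critical \<epsilon> k y0" and near: "norm (y0 - x0) < r / 4" for \<epsilon> y0
  proof (rule ccontr)
    assume less: "\<not> t \<le> \<rho> y0"
    have "y0 \<in> \<Omega>" "y0 \<in> ball x0 (r/2)" using crit by (auto simp: critical_def)
    then have \<rho>0: "0 < \<rho> y0" using near_iff by blast
    have ne: "y0 \<noteq> x0" using less t(2) by auto
    define Q where "Q = L + dpen \<epsilon> k (\<rho> y0)"
    have Qk: "k * \<gamma> * \<rho> y0 powr (\<gamma> - 1) \<le> Q"
      using L_ge(1) \<epsilon> by (simp add: Q_def dpen_def)
    have "((Q1 / (k * \<gamma>)) powr (1 / (\<gamma> - 1))) powr (\<gamma> - 1) \<le> \<rho> y0 powr (\<gamma> - 1)"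
      using less \<rho>0 \<gamma>(2) by (intro powr_mono2') (auto simp: t_def)
    then have "Q1 / (k * \<gamma>) \<le> \<rho> y0 powr (\<gamma> - 1)"
      using \<gamma>(2) Q1(1) k\<gamma> by (simp add: powr_powr)
    then have "Q1 \<le> k * \<gamma> * \<rho> y0 powr (\<gamma> - 1)" using k\<gamma> by (simp add: field_simps)
    then have QQ: "Q1 \<le> Q" using Qk by linarith
    then have Q0: "0 < Q" using Q1(1) by linarith
    have KQ0: "0 < K * Q" using K_ge Q0 by simp
    \<comment> \<open>The second entry keeps jumps from more than halving \<rho>, as the singular
      term requires.\<close>
    define \<tau> where "\<tau> = min (1 / (K * Q)) (\<rho> y0 / (2 * M))"
    have \<tau>0: "0 < \<tau>" using KQ0 \<rho>0 M_ge by (auto simp: \<tau>_def)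
    have "M * \<tau> \<le> M * (\<rho> y0 / (2 * M))" using M_ge by (intro mult_left_mono) (auto simp: \<tau>_def)
    also have "\<dots> = \<rho> y0 / 2"
    proof -
      have "c * (\<rho> y0 / (2 * c)) = \<rho> y0 / 2" if "2 \<le> c" for c :: real using that by simp
      from this[OF M_ge] show ?thesis .
    qed
    finally have M\<tau>: "M * \<tau> \<le> \<rho> y0 / 2" .
    have "b0 * (Q / 2) powr m \<le> A0 + C2 * (K * Q) powr \<sigma> + R * (C1 * \<tau> powr (- \<sigma>))"
      unfolding Q_def
      using less t(2) \<epsilon> k(1) \<tau>0 M\<tau>
      by (intro critical_estimate[OF crit ne near]) (auto simp: \<tau>_def Q_def)
    moreover have "b0 * (Q / 2) powr m = c * Q powr m"
      using Q0 by (simp add: c_def powr_divide)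
    moreover have "R * (C1 * \<tau> powr (- \<sigma>)) \<le> R * (C1 * ((K * Q) powr \<sigma> + (\<rho> y0 / (2 * M)) powr (- \<sigma>)))"
    proof -
      have "\<tau> powr (- \<sigma>) \<le> (1 / (K * Q)) powr (- \<sigma>) + (\<rho> y0 / (2 * M)) powr (- \<sigma>)"
        by (cases "1 / (K * Q) \<le> \<rho> y0 / (2 * M)") (auto simp: \<tau>_def min_def)
      also have "(1 / (K * Q)) powr (- \<sigma>) = (K * Q) powr \<sigma>"
        using KQ0 by (simp add: powr_minus powr_divide)
      finally show ?thesis using R0 C1_pos by (intro mult_left_mono) auto
    qed
    moreover have "(\<rho> y0 / (2 * M)) powr (- \<sigma>) \<le> (2 * M) powr \<sigma> * (1 / (k * \<gamma>)) powr \<kappa> * Q powr \<kappa>"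
    proof -
      have "(\<rho> y0 / (2 * M)) powr (- \<sigma>) = (2 * M) powr \<sigma> * \<rho> y0 powr (- \<sigma>)"
        using \<rho>0 M_ge by (simp add: powr_minus powr_divide field_simps)
      \<comment> \<open>By the choice of \<kappa>, the tail cost is a power \<kappa> of the slope,
        hence at most a multiple of \<open>Q powr \<kappa>\<close>.\<close>
      also have "\<rho> y0 powr (- \<sigma>) = (\<rho> y0 powr (\<gamma> - 1)) powr \<kappa>" by (simp add: powr_powr \<kappa>(3))
      also have "\<dots> \<le> (1 / (k * \<gamma>) * Q) powr \<kappa>"
        using Qk k\<gamma> \<kappa>(2) by (intro powr_mono2) (auto simp: field_simps)
      also have "\<dots> = (1 / (k * \<gamma>)) powr \<kappa> * Q powr \<kappa>" by (rule powr_mult)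
      finally show ?thesis by (simp add: mult.assoc mult_left_mono)
    qed
    then have "R * C1 * (\<rho> y0 / (2 * M)) powr (- \<sigma>) \<le> C * Q powr \<kappa>"
      using R0 C1_pos mult_left_mono[of _ _ "R * C1"] by (simp add: C_def mult.assoc)
    moreover have "(K * Q) powr \<sigma> = K powr \<sigma> * Q powr \<sigma>" by (rule powr_mult)
    ultimately have "c * Q powr m \<le> A0 + B * Q powr \<sigma> + C * Q powr \<kappa>"
      by (simp add: B_def algebra_simps)
    with Q1(2)[OF QQ] show False by linarith
  qed
  with t show ?thesis by blast
qed

text \<open>As \<epsilon> tends to 0, the uniform lower bound on levels leaves a true maximum
  \<open>y0\<close> for the bounded penalty. If \<open>y0\<close> were not \<open>x0\<close>, the
  contact estimate would contradict the threshold; so \<open>x0\<close> is the maximum, and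
  comparison with \<open>y\<close> gives the claim.\<close>

lemma increment_le_penalized:
  assumes small: "dpen 0 k (\<rho> x0) * M \<le> L / 4"
    and threshold: "\<And>Q. L \<le> Q \<Longrightarrow> A0 + (C2 + R * C1) * (K * Q) powr \<sigma> < b0 * (Q / 2) powr m"
    and y: "y \<in> \<Omega>" "y \<in> ball x0 (r/2)"
  shows "u y - u x0 \<le> L * norm (y - x0) + k * \<rho> x0 powr \<gamma>"
proof -
  obtain t where t: "0 < t" "t \<le> \<rho> x0"
    "\<And>\<epsilon> y0. 0 < \<epsilon> \<Longrightarrow> critical \<epsilon> k y0 \<Longrightarrow> norm (y0 - x0) < r / 4 \<Longrightarrow> t \<le> \<rho> y0"
    using critical_level_lower_bound by blast
  obtain y0 where y0: "y0 \<in> \<Omega>" "y0 \<in> cball x0 (r/4)" "t \<le> \<rho> y0"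
    "\<And>y. y \<in> cball x0 (r/4) \<Longrightarrow> t \<le> \<rho> y \<Longrightarrow> F 0 k y \<le> F 0 k y0"
    using F_attains_max[OF t(1,2)] by blast
  have y0b: "y0 \<in> ball x0 (r/2)" using y0(2) r_pos by simp
  have F_split: "F \<epsilon> k z = F 0 k z - \<epsilon> / \<rho> z" for \<epsilon> z by (simp add: F_def pen_def)
  \<comment> \<open>A maximum point of \<open>F \<epsilon> k\<close> has level at least
    \<open>t\<close>, so it competes with \<open>y0\<close> in the compact set; dropping the
    singular term there only increases the value.\<close>
  have global: "F 0 k z \<le> F 0 k y0" if z: "z \<in> \<Omega>" "z \<in> ball x0 (r/2)" for z
  proof (rule tendsto_upperbound)
    have "((\<lambda>\<epsilon>. F 0 k z - \<epsilon> / \<rho> z) \<longlongrightarrow> F 0 k z - 0 / \<rho> z) (at_right 0)"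
      by (intro tendsto_intros) (use near_iff z in auto)
    then show "((\<lambda>\<epsilon>. F 0 k z - \<epsilon> / \<rho> z) \<longlongrightarrow> F 0 k z) (at_right 0)" by simp
    have "F 0 k z - \<epsilon> / \<rho> z \<le> F 0 k y0" if \<epsilon>: "0 < \<epsilon>" "\<epsilon> < \<rho> x0" for \<epsilon>
    proof -
      obtain w where w: "critical \<epsilon> k w" "norm (w - x0) < r / 4"
        using critical_exists \<epsilon> by (meson less_imp_le)
      have "t \<le> \<rho> w" using t(3) \<epsilon> w by blast
      have "F 0 k z - \<epsilon> / \<rho> z \<le> F 0 k w - \<epsilon> / \<rho> w"
        using w(1) z unfolding critical_def F_split[of \<epsilon>] by blast
      also have "\<dots> \<le> F 0 k w" using \<epsilon> t(1) \<open>t \<le> \<rho> w\<close> by simp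
      also have "\<dots> \<le> F 0 k y0"
        using w(2) \<open>t \<le> \<rho> w\<close> by (intro y0(4)) (auto simp: dist_norm norm_minus_commute)
      finally show ?thesis .
    qed
    then show "\<forall>\<^sub>F \<epsilon> in at_right 0. F 0 k z - \<epsilon> / \<rho> z \<le> F 0 k y0"
      using \<rho>_x0 by (auto simp: eventually_at_right_field)
  qed simp
  then have crit: "critical 0 k y0" unfolding critical_def using y0(1) y0b by blast
  have near: "norm (y0 - x0) < r / 4"
    using large_F(1)[OF y0(1) y0b _ _ global[OF x0(1) x0_near]] \<rho>_x0 by simp
  have "y0 = x0"
  proof (rule ccontr)
    assume ne: "y0 \<noteq> x0"
    define Q where "Q = L + dpen 0 k (\<rho> y0)"
    have QL: "L \<le> Q" using dpen_nonneg[of 0 k] k(1) by (simp add: Q_def)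
    have KQ0: "0 < K * Q" using K_ge QL L_ge(1) by simp
    \<comment> \<open>If \<open>y0\<close> is deeper than \<open>x0\<close>, the slope is even
      smaller than at \<open>x0\<close>, where it is small by assumption.\<close>
    have "\<rho> y0 \<le> \<rho> x0 \<or> dpen 0 k (\<rho> y0) * M \<le> L / 4"
    proof (cases "\<rho> y0 \<le> \<rho> x0")
      case False
      then have "\<rho> y0 powr (\<gamma> - 1) \<le> \<rho> x0 powr (\<gamma> - 1)"
        using \<rho>_x0 \<gamma>(2) by (intro powr_mono2') auto
      then have "dpen 0 k (\<rho> y0) \<le> dpen 0 k (\<rho> x0)"
        using k(1) \<gamma>(1) by (simp add: dpen_def)
      then have "dpen 0 k (\<rho> y0) * M \<le> dpen 0 k (\<rho> x0) * M" using M_ge by (intro mult_right_mono) auto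
      then show ?thesis using small by linarith
    qed simp
    \<comment> \<open>With \<epsilon> = 0 the cutoff \<tau> may be \<open>1 / (K * Q)\<close>
      itself, independently of the level of \<open>y0\<close>. This keeps the threshold free of
      \<open>k\<close>.\<close>
    then have "b0 * (Q / 2) powr m
        \<le> A0 + C2 * (K * Q) powr \<sigma> + R * (C1 * (1 / (K * Q)) powr (- \<sigma>))"
      unfolding Q_def using KQ0 k(1)
      by (intro critical_estimate[OF crit ne near]) (auto simp: Q_def)
    moreover have "(1 / (K * Q)) powr (- \<sigma>) = (K * Q) powr \<sigma>"
      using KQ0 by (simp add: powr_minus powr_divide)
    ultimately show False using threshold[OF QL] by (simp add: algebra_simps)
  qed
  then have "F 0 k y \<le> F 0 k x0" using global[OF y] by simp
  moreover have "0 \<le> k * \<rho> y powr \<gamma>" using k(1) by simp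
  ultimately show ?thesis by (simp add: F_def pen_def)
qed

end

text \<open>The threshold does not involve \<open>k\<close>, and both smallness conditions on
  \<open>k\<close> hold eventually, so \<open>k\<close> can tend to 0 with \<open>L\<close>
  fixed.\<close>

lemma increment_le:
  assumes threshold: "\<And>Q. L \<le> Q \<Longrightarrow> A0 + (C2 + R * C1) * (K * Q) powr \<sigma> < b0 * (Q / 2) powr m"
    and y: "y \<in> \<Omega>" "y \<in> ball x0 (r/2)"
  shows "u y - u x0 \<le> L * norm (y - x0)"
proof (rule tendsto_lowerbound)
  have "((\<lambda>k. L * norm (y - x0) + k * \<rho> x0 powr \<gamma>) \<longlongrightarrow> L * norm (y - x0) + 0 * \<rho> x0 powr \<gamma>) (at_right 0)"
    by (intro tendsto_intros)
  then show "((\<lambda>k. L * norm (y - x0) + k * \<rho> x0 powr \<gamma>) \<longlongrightarrow> L * norm (y - x0)) (at_right 0)" by simp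
  have "((\<lambda>k. k * (\<rho> x0 + M * r) powr \<gamma>) \<longlongrightarrow> 0 * (\<rho> x0 + M * r) powr \<gamma>) (at_right 0)"
    by (intro tendsto_intros)
  then have 1: "\<forall>\<^sub>F k in at_right 0. k * (\<rho> x0 + M * r) powr \<gamma> < 1"
    by (rule order_tendstoD(2)) simp
  have "((\<lambda>k. dpen 0 k (\<rho> x0) * M) \<longlongrightarrow> (0 / (\<rho> x0)\<^sup>2 + 0 * \<gamma> * \<rho> x0 powr (\<gamma> - 1)) * M) (at_right 0)"
    unfolding dpen_def using \<rho>_x0 by (intro tendsto_intros) auto
  then have 2: "\<forall>\<^sub>F k in at_right 0. dpen 0 k (\<rho> x0) * M < L / 4"
    using L_ge(1) by (intro order_tendstoD(2)) auto
  show "\<forall>\<^sub>F k in at_right 0. u y - u x0 \<le> L * norm (y - x0) + k * \<rho> x0 powr \<gamma>"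
    using 1 2 eventually_at_right_less[of "0::real"]
  proof eventually_elim
    case (elim k)
    then show ?case using threshold y by (intro increment_le_penalized) auto
  qed
qed simp

end

section \<open>The Lipschitz bound\<close>

text \<open>The radius and \<open>L\<close> precede \<nu>, \<open>u\<close> and the centre
  \<open>x\<close> in the quantifiers: the bounds on \<open>L\<close> involve only the chart, the
  constants and \<open>R0\<close>.\<close>

lemma local_lipschitz:
  fixes \<Omega> :: "'a::euclidean_space set" and R0 :: real
  assumes "open \<Omega>" "C1_boundary \<Omega>" "p \<in> closure \<Omega>"
    and "0 < \<sigma>" "\<sigma> < m" "0 < b0"
  shows "\<exists>r>0. \<exists>L. \<forall>\<nu> u. nonlocal_subsolution \<Omega> \<nu> \<sigma> C1 C2 m b0 A0 u \<and> osc u (closure \<Omega>) = R0 \<longrightarrow>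
    (\<forall>x\<in>\<Omega> \<inter> ball p (r/2). \<forall>y\<in>\<Omega> \<inter> ball x (r/2). u y - u x \<le> L * norm (y - x))"
proof -
  obtain r \<rho> G where chart: "level_chart \<Omega> p r \<rho> G"
    using level_chart_exists assms(1-3) by blast
  then have r: "0 < r" unfolding level_chart_def by simp
  define K where "K = (norm (G p) + 1) / ((1 - \<sigma> / m) / 2)"
  have "0 < m" "0 < b0 * (1/2) powr m" using assms by auto
  then obtain Q0 where Q0: "1 \<le> Q0"
    "\<And>Q. Q0 \<le> Q \<Longrightarrow> A0 + (C2 + R0 * C1) * K powr \<sigma> * Q powr \<sigma> + 0 * Q powr \<sigma> < b0 * (1/2) powr m * Q powr m"
    using powr_sum_less[OF _ assms(5,5)] by blast
  \<comment> \<open>The entries secure the threshold, \<open>4 / r \<le> L\<close> and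
    \<open>R0 + 2 < L * (r / 4)\<close>, in this order.\<close>
  define L where "L = max Q0 (max (4 / r) (4 * (R0 + 3) / r))"
  have "u y - u x \<le> L * norm (y - x)"
    if sub: "nonlocal_subsolution \<Omega> \<nu> \<sigma> C1 C2 m b0 A0 u" and R0: "osc u (closure \<Omega>) = R0"
      and x: "x \<in> \<Omega>" "x \<in> ball p (r/2)" and y: "y \<in> \<Omega>" "y \<in> ball x (r/2)" for \<nu> u x y
  proof -
    have "R0 + 2 < 4 * (R0 + 3) / r * (r / 4)" using r by simp
    also have "\<dots> \<le> L * (r / 4)" using r by (intro mult_right_mono) (auto simp: L_def)
    finally have "R0 + 2 < L * (r / 4)" .
    then interpret B: barrier_setting \<Omega> \<nu> \<sigma> C1 C2 m b0 A0 u p x r L \<rho> G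
      using chart x Q0(1) sub R0
      by (intro barrier_setting.intro barrier_setting_axioms.intro) (auto simp: L_def)
    show ?thesis
    proof (rule B.increment_le[OF _ y])
      fix Q assume Q: "L \<le> Q"
      then have "Q0 \<le> Q" by (simp add: L_def)
      moreover have "B.K = K" unfolding K_def B.K_def B.\<gamma>_def ..
      moreover have "(K * Q) powr \<sigma> = K powr \<sigma> * Q powr \<sigma>" by (rule powr_mult)
      moreover have "(Q / 2) powr m = (1/2) powr m * Q powr m"
        using Q B.L_ge(1) by (simp add: powr_divide)
      ultimately show "A0 + (C2 + B.R * C1) * (B.K * Q) powr \<sigma> < b0 * (Q / 2) powr m"
        using Q0(2)[of Q] by (simp add: R0 mult.assoc)
    qed
  qed
  then show ?thesis using r by (intro exI[of _ r] conjI exI[of _ L]) auto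
qed

text \<open>Finitely many charts cover the closure. Pairs closer than a fixed \<open>d\<close> share
  a chart; for the others the oscillation divided by \<open>d\<close> is a Lipschitz
  constant.\<close>

lemma uniform_lipschitz:
  fixes \<Omega> :: "'a::euclidean_space set" and R0 :: real
  assumes "bounded \<Omega>" "open \<Omega>" "C1_boundary \<Omega>" "0 < \<sigma>" "\<sigma> < m" "0 < b0"
  shows "\<exists>L>0. \<forall>\<nu> u. nonlocal_subsolution \<Omega> \<nu> \<sigma> C1 C2 m b0 A0 u \<and> osc u (closure \<Omega>) = R0 \<longrightarrow>
    (\<forall>x\<in>\<Omega>. \<forall>y\<in>\<Omega>. \<bar>u x - u y\<bar> \<le> L * norm (x - y))"
proof -
  have "\<forall>p\<in>closure \<Omega>. \<exists>r>0. \<exists>L. \<forall>\<nu> u. nonlocal_subsolution \<Omega> \<nu> \<sigma> C1 C2 m b0 A0 u \<and> osc u (closure \<Omega>) = R0 \<longrightarrow>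
    (\<forall>x\<in>\<Omega> \<inter> ball p (r/2). \<forall>y\<in>\<Omega> \<inter> ball x (r/2). u y - u x \<le> L * norm (y - x))"
    using local_lipschitz[OF assms(2,3) _ assms(4-6)] by blast
  then obtain r L where r: "\<And>p. p \<in> closure \<Omega> \<Longrightarrow> 0 < r p"
    and L: "\<And>p \<nu> u x y. \<lbrakk>p \<in> closure \<Omega>; nonlocal_subsolution \<Omega> \<nu> \<sigma> C1 C2 m b0 A0 u;
      osc u (closure \<Omega>) = R0; x \<in> \<Omega>; x \<in> ball p (r p / 2); y \<in> \<Omega>; y \<in> ball x (r p / 2)\<rbrakk>
      \<Longrightarrow> u y - u x \<le> L p * norm (y - x)"
    by (metis IntI)
  have "compact (closure \<Omega>)" using assms(1) by simp
  moreover have "closure \<Omega> \<subseteq> (\<Union>p\<in>closure \<Omega>. ball p (r p / 4))" using r by auto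
  ultimately obtain F where F: "F \<subseteq> closure \<Omega>" "finite F" "closure \<Omega> \<subseteq> (\<Union>p\<in>F. ball p (r p / 4))"
    using compactE_image[of "closure \<Omega>" "closure \<Omega>" "\<lambda>p. ball p (r p / 4)"] by (metis open_ball)
  \<comment> \<open>At most a quarter of every radius, so a point within \<open>d\<close> of
    \<open>x\<close> lies in the ball around \<open>x\<close> used locally. The entry 1 keeps the
    set nonempty.\<close>
  define d where "d = Min (insert 1 ((\<lambda>p. r p / 4) ` F))"
  have d: "0 < d" using F(1,2) r by (auto simp: d_def subset_iff)
  have d_le: "d \<le> r p / 4" if "p \<in> F" for p
    unfolding d_def using F(2) that by (intro Min_le) auto
  define L' where "L' = (\<Sum>p\<in>F. \<bar>L p\<bar>) + \<bar>R0\<bar> / d + 1"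
  have sum0: "0 \<le> (\<Sum>p\<in>F. \<bar>L p\<bar>)" by (intro sum_nonneg) auto
  have L'0: "0 < L'" "\<bar>R0\<bar> / d \<le> L'" using sum0 d by (auto simp: L'_def add_nonneg_pos)
  have L'_ge: "L p \<le> L'" if "p \<in> F" for p
  proof -
    have "\<bar>L p\<bar> \<le> (\<Sum>p\<in>F. \<bar>L p\<bar>)" using F(2) that by (intro member_le_sum) auto
    moreover have "0 \<le> \<bar>R0\<bar> / d" using d by simp
    ultimately show ?thesis unfolding L'_def by linarith
  qed
  have main: "u y - u x \<le> L' * norm (x - y)"
    if sub: "nonlocal_subsolution \<Omega> \<nu> \<sigma> C1 C2 m b0 A0 u" and R0: "osc u (closure \<Omega>) = R0"
      and x: "x \<in> \<Omega>" and y: "y \<in> \<Omega>" for \<nu> u x y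
  proof (cases "norm (x - y) < d")
    case True
    obtain p where p: "p \<in> F" "x \<in> ball p (r p / 4)" using F(3) x closure_subset by blast
    have "0 < r p" using p(1) F(1) r by blast
    then have "u y - u x \<le> L p * norm (y - x)"
      using p F(1) True d_le[OF p(1)] by (intro L[OF _ sub R0 x _ y]) (auto simp: dist_norm)
    also have "\<dots> \<le> L' * norm (y - x)" using L'_ge[OF p(1)] by (intro mult_right_mono) auto
    finally show ?thesis by (simp add: norm_minus_commute)
  next
    case False
    interpret nonlocal_subsolution \<Omega> \<nu> \<sigma> C1 C2 m b0 A0 u by (rule sub)
    have "u y - u x \<le> \<bar>R0\<bar> / d * d" using diff_le_R[of y x] R0 in_closure x y d by simp
    also have "\<dots> \<le> L' * norm (x - y)" using False L'0 d by (intro mult_mono) auto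
    finally show ?thesis .
  qed
  have "\<bar>u x - u y\<bar> \<le> L' * norm (x - y)"
    if "nonlocal_subsolution \<Omega> \<nu> \<sigma> C1 C2 m b0 A0 u" "osc u (closure \<Omega>) = R0" "x \<in> \<Omega>" "y \<in> \<Omega>" for \<nu> u x y
    using main[OF that] main[OF that(1,2,4,3)] by (simp add: abs_le_iff norm_minus_commute)
  then show ?thesis using L'0(1) by blast
qed

theorem theorem3p5:
  fixes \<Omega> :: "(real ^ 'n) set" and \<sigma> m b0 A0 C1 C2 :: real
  assumes "bounded \<Omega>" and "C1_domain \<Omega>"
    and "0 < \<sigma>" and "\<sigma> < 1" and "m > \<sigma>" and "b0 > 0" and "A0 \<ge> 0"
    and "C1 > 0" and "C2 > 0"
  shows "\<exists>L :: real \<Rightarrow> real. (\<forall>R. L R > 0) \<and>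
    (\<forall>(\<nu> :: real ^ 'n \<Rightarrow> (real ^ 'n) measure) (u :: real ^ 'n \<Rightarrow> real).
       (\<forall>x\<in>closure \<Omega>. regular_borel_measure (\<nu> x)) \<and>
       M0 \<Omega> \<nu> \<and> M1 \<Omega> \<nu> \<sigma> C1 \<and> M2 \<Omega> \<nu> \<sigma> C2 \<and>
       bounded (u ` closure \<Omega>) \<and> viscosity_subsolution \<Omega> \<nu> m b0 A0 u \<longrightarrow>
       (\<forall>x\<in>\<Omega>. \<forall>y\<in>\<Omega>. \<bar>u x - u y\<bar> \<le> L (osc u (closure \<Omega>)) * norm (x - y)))"
proof -
  have \<Omega>: "open \<Omega>" "C1_boundary \<Omega>" using assms(2) unfolding C1_domain_def by auto
  \<comment> \<open>One constant for each value of the oscillation, so that choice yields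
    \<open>L\<close> as a function of it.\<close>
  have "\<forall>R0. \<exists>L>0. \<forall>\<nu> u. nonlocal_subsolution \<Omega> \<nu> \<sigma> C1 C2 m b0 A0 u \<and> osc u (closure \<Omega>) = R0 \<longrightarrow>
    (\<forall>x\<in>\<Omega>. \<forall>y\<in>\<Omega>. \<bar>u x - u y\<bar> \<le> L * norm (x - y))"
    using uniform_lipschitz[OF assms(1) \<Omega> assms(3,5,6)] by blast
  then obtain L where L: "\<And>R0. 0 < L R0"
    "\<And>R0 \<nu> u x y. \<lbrakk>nonlocal_subsolution \<Omega> \<nu> \<sigma> C1 C2 m b0 A0 u; osc u (closure \<Omega>) = R0; x \<in> \<Omega>; y \<in> \<Omega>\<rbrakk>
      \<Longrightarrow> \<bar>u x - u y\<bar> \<le> L R0 * norm (x - y)"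
    by metis
  have "nonlocal_subsolution \<Omega> \<nu> \<sigma> C1 C2 m b0 A0 u"
    if "\<forall>x\<in>closure \<Omega>. regular_borel_measure (\<nu> x)" "M0 \<Omega> \<nu>" "M1 \<Omega> \<nu> \<sigma> C1" "M2 \<Omega> \<nu> \<sigma> C2"
      "bounded (u ` closure \<Omega>)" "viscosity_subsolution \<Omega> \<nu> m b0 A0 u" for \<nu> u
    using that assms \<Omega>
    by unfold_locales (auto simp: regular_borel_measure_def)
  then show ?thesis using L by (intro exI[of _ L]) blast
qed

end
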